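(* Let $G=G_{n,1/2}$. Let $X^{(2,0)}_n$, $X^{(1,1)}_n$, $X^{(0,2)}_n$ denote, respectively, the number of unordered partitions of $V(G)$ into two sets $\{A,B\}$ such that both $G[A]$ and $G[B]$ have all degrees even; such that one of $G[A],G[B]$ has all degrees even and the other has all degrees odd; and such that both have all degrees odd. Let $c=\prod_{i=0}^{\infty}(1-2^{-2i-1})=\big(\sum_{j=0}^{\infty}\prod_{i=1}^{j}(2^i-1)^{-1}\big)^{-1}$. Then $X^{(2,0)}_n\xrightarrow{d}X$ and $X^{(1,1)}_n\xrightarrow{d}X$, where $\Pr(X=2^k)=c\prod_{i=1}^k(2^i-1)^{-1}$ for $k\in\mathbb N\cup\{0\}$ and $\Pr(X=x)=0$ if $x$ is not of the form $2^k$ with $k\in\mathbb N\cup\{0\}$. Furthermore, as $n$ runs over even integers, $X^{(0,2)}_n\xrightarrow{d}Z$, where $\Pr(Z=2^k)=c\,2^{-k}\prod_{i=1}^k(2^i-1)^{-1}$ for $k\in\mathbb N\cup\{0\}$, $\Pr(Z=0)=1/3$, and $\Pr(Z=x)=0$ if $x\neq 0$ and $x$ is not of the form $2^k$ with $k\in\mathbb N\cup\{0\}$.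
   Context: $G_{n,1/2}$ is the binomial random graph on vertex set $[n]$ with each edge present independently with probability $1/2$. Empty products equal $1$. *)

theory Defs
  imports "HOL-Probability.Probability"
begin

text \<open>A finite simple graph is a pair of a vertex set and a set of edges, the edges being
  two-element sets of vertices.\<close>

type_synonym 'a graph = "'a set \<times> 'a set set"

definition verts :: "'a graph \<Rightarrow> 'a set" where
  "verts G = fst G"

definition edges :: "'a graph \<Rightarrow> 'a set set" where
  "edges G = snd G"

definition induced_subgraph :: "'a graph \<Rightarrow> 'a set \<Rightarrow> 'a graph" where
  "induced_subgraph G A = (A, {e \<in> edges G. e \<subseteq> A})"

definition degree :: "'a graph \<Rightarrow> 'a \<Rightarrow> nat" where
  "degree G v = card {e \<in> edges G. v \<in> e}"

definition all_degrees_even :: "'a graph \<Rightarrow> bool" where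
  "all_degrees_even G \<longleftrightarrow> (\<forall>v \<in> verts G. even (degree G v))"

definition all_degrees_odd :: "'a graph \<Rightarrow> bool" where
  "all_degrees_odd G \<longleftrightarrow> (\<forall>v \<in> verts G. odd (degree G v))"

text \<open>The vertex set is \<open>[n] = {1..n}\<close>. Each potential edge gets its own coin,
  and \<open>Pi_pmf\<close> makes the coins independent.\<close>

definition potential_edges :: "nat \<Rightarrow> nat set set" where
  "potential_edges n = {e. e \<subseteq> {1..n} \<and> card e = 2}"

definition binomial_random_graph :: "nat \<Rightarrow> real \<Rightarrow> nat graph pmf" where
  "binomial_random_graph n p =
     map_pmf (\<lambda>f. ({1..n}, {e \<in> potential_edges n. f e}))
       (Pi_pmf (potential_edges n) False (\<lambda>_. bernoulli_pmf p))"

text \<open>Partitions are unordered, so they are counted as sets \<open>{A, B}\<close>; a part may be empty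
  (the empty graph has all degrees even and all degrees odd).\<close>

definition bipartitions :: "('a graph \<Rightarrow> bool) \<Rightarrow> ('a graph \<Rightarrow> bool) \<Rightarrow> 'a graph \<Rightarrow> 'a set set set" where
  "bipartitions P Q G =
     {{A, B} | A B. A \<union> B = verts G \<and> A \<inter> B = {} \<and>
        P (induced_subgraph G A) \<and> Q (induced_subgraph G B)}"

definition X20 :: "'a graph \<Rightarrow> nat" where
  "X20 G = card (bipartitions all_degrees_even all_degrees_even G)"

definition X11 :: "'a graph \<Rightarrow> nat" where
  "X11 G = card (bipartitions all_degrees_even all_degrees_odd G)"

definition X02 :: "'a graph \<Rightarrow> nat" where
  "X02 G = card (bipartitions all_degrees_odd all_degrees_odd G)"

definition law :: "'a pmf \<Rightarrow> ('a \<Rightarrow> real) \<Rightarrow> real measure" where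
  "law p f = distr (measure_pmf p) borel f"

end

theory Submission
  imports Defs "HOL-Library.Z2" "HOL-Computational_Algebra.Primes"
begin

text \<open>Encode a partition of the vertices by a vector \<open>x\<close> over the field with two elements. All
  three degree conditions become linear systems \<open>M x = diag M + t\<close>, where \<open>M\<close> is the Laplacian \<open>L\<close>
  (\<open>t = 0\<close> for even-even and \<open>t = 1\<close> for odd-odd) or \<open>L + 1\<close> (even-odd, \<open>t = 0\<close>). The diagonal
  of a symmetric matrix over this field always lies in its range, so the counts are the size of a
  kernel, except that for odd-odd the system is solvable only if the all-ones vector is orthogonal
  to the kernel. For a random graph, \<open>L\<close> with one row and column deleted is a uniformly random
  symmetric matrix; \<open>L + 1\<close> reduces to one as well.

  Bordering a uniform symmetric matrix of corank \<open>k\<close> by a new row and column leads to corank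
  \<open>k - 1\<close>, \<open>k\<close>, \<open>k + 1\<close> with probability \<open>1 - 2\<^sup>-\<^sup>k\<close>, \<open>2\<^sup>-\<^sup>k\<^sup>-\<^sup>1\<close>, \<open>2\<^sup>-\<^sup>k\<^sup>-\<^sup>1\<close>, and the new
  coordinate vanishes on the kernel in the first two cases. This recursion has an explicit solution,
  whose limit is read off.\<close>

section \<open>Limit constants and the corank recursion\<close>

text \<open>The Laplacian is singular for every graph, because its rows sum to zero. Fixing
  \<open>x a = 0\<close>, which picks one of the two vectors of an unordered partition, removes this
  forced degeneracy. What is left is uniform because the edges inside \<open>I\<close> give the
  off-diagonal entries, while the edge from u to \<open>a\<close> enters only the diagonal entry at
  u. For even-odd, the vector 1 is an eigenvector of \<open>L + 1\<close> with value 1, and whether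
  it is isotropic depends on the parity of n; this forces two separate reductions.

  Solvability for odd-odd depends on the kernel itself and not only on its size. A change of basis
  turns the all-ones functional into a single coordinate, and that coordinate is taken to be the one
  bordered last, so the recursion has to carry the size together with one bit. Pointwise limits of
  probabilities give convergence in distribution only if the limit has total mass 1: this is the
  series identity for c, and the value 1/3 comes from the same series at 1/2.\<close>

definition wt :: "nat \<Rightarrow> real" where
  "wt k = (\<Prod>i=1..k. inverse (2 ^ i - 1))"

lemma wt_0 [simp]: "wt 0 = 1"
  by (simp add: wt_def)

lemma wt_Suc: "wt (Suc k) = wt k / (2 ^ Suc k - 1)"
  by (simp add: wt_def divide_inverse)

lemma wt_pos: "wt k > 0"
  unfolding wt_def by (intro prod_pos) simp

text \<open>Detailed balance for the corank under bordering: the step from k + 1 down to k has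
  probability \<open>1 - 1 / 2 ^ Suc k\<close>, the step back up \<open>1 / 2 ^ Suc k\<close>. This
  collapses limits that involve two levels to a single weight.\<close>

lemma wt_Suc_mult: "wt (Suc k) * (1 - 1 / 2 ^ Suc k) = wt k / 2 ^ Suc k"
proof -
  have "(2::real) ^ Suc k > 1" by (rule one_less_power) auto
  then show ?thesis unfolding wt_Suc by (simp add: field_simps)
qed

lemma summable_wt_power:
  assumes "0 \<le> z" "z \<le> 1"
  shows "summable (\<lambda>k. wt k * z ^ k)"
proof (rule summable_ratio_test[where c = "1/2" and N = 1])
  fix k :: nat assume "1 \<le> k"
  then have "(2::real) ^ 1 \<le> 2 ^ k" by (intro power_increasing) auto
  then have *: "z / (2 ^ Suc k - 1) \<le> 1 / 2" using assms by (simp add: field_simps)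
  have "norm (wt (Suc k) * z ^ Suc k) = wt (Suc k) * z ^ Suc k"
    using assms wt_pos[of "Suc k"] by (simp add: abs_mult)
  also have "\<dots> = (wt k * z ^ k) * (z / (2 ^ Suc k - 1))"
    by (simp add: wt_Suc)
  also have "\<dots> \<le> (wt k * z ^ k) * (1 / 2)"
    using * assms wt_pos[of k] by (intro mult_left_mono) auto
  finally show "norm (wt (Suc k) * z ^ Suc k) \<le> 1 / 2 * norm (wt k * z ^ k)"
    using assms wt_pos[of k] by simp
qed simp

definition wt_series :: "real \<Rightarrow> real" where
  "wt_series z = (\<Sum>k. wt k * z ^ k)"

text \<open>The functional equation is \<open>(2 ^ k - 1) * wt k = wt (k - 1)\<close> summed against \<open>z ^ k\<close>.\<close>

lemma wt_series_double:
  assumes "0 \<le> z" "2 * z \<le> 1"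
  shows "wt_series (2 * z) = (1 + z) * wt_series z"
proof -
  have s: "summable (\<lambda>k. wt k * z ^ k)" "summable (\<lambda>k. wt k * (2 * z) ^ k)"
    using assms by (intro summable_wt_power; simp)+
  define d where "d k = wt k * (2 * z) ^ k - wt k * z ^ k" for k
  have d: "summable d" unfolding d_def by (intro summable_diff s)
  have dSuc: "d (Suc k) = z * (wt k * z ^ k)" for k
  proof -
    have "(2::real) ^ Suc k > 1" by (rule one_less_power) auto
    then have "wt (Suc k) * (2 ^ Suc k - 1) = wt k" by (simp add: wt_Suc)
    moreover have "d (Suc k) = wt (Suc k) * (2 ^ Suc k - 1) * z ^ Suc k"
      by (simp add: d_def power_mult_distrib algebra_simps)
    ultimately show ?thesis by simp
  qed
  have "wt_series (2 * z) - wt_series z = suminf d"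
    unfolding wt_series_def d_def by (rule suminf_diff[OF s(2) s(1)])
  also have "\<dots> = (\<Sum>k. d (Suc k))"
    using suminf_split_head[OF d] by (simp add: d_def)
  also have "\<dots> = z * wt_series z"
    unfolding dSuc wt_series_def by (rule suminf_mult[OF s(1)])
  finally show ?thesis by (simp add: algebra_simps)
qed

text \<open>This product and the next two multiply the factors 1 - 2^-i over all i from 1, over even
  i and over odd i; \<open>limc\<close> is the infinite product over odd i.\<close>

definition qprod :: "nat \<Rightarrow> real" where
  "qprod N = (\<Prod>j<N. 1 - 1/2 * (1/2) ^ j)"

definition eprod :: "nat \<Rightarrow> real" where
  "eprod s = (\<Prod>j<s. 1 - 1/4 * (1/4) ^ j)"

definition oprod :: "nat \<Rightarrow> real" where
  "oprod s = (\<Prod>j<s. 1 - 1/2 * (1/4) ^ j)"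

lemma eprod_0 [simp]: "eprod 0 = 1" by (simp add: eprod_def)

lemma qprod_double: "qprod (2 * s) = oprod s * eprod s"
proof (induction s)
  case (Suc s)
  have "((1::real) / 2) ^ (2 * s) = (1 / 4) ^ s" by (simp add: power_mult power2_eq_square)
  with Suc show ?case by (simp add: qprod_def oprod_def eprod_def)
qed (simp add: qprod_def oprod_def eprod_def)

lemma convergent_prod_geometric:
  assumes "0 \<le> a" "0 \<le> q" "q < (1::real)"
  shows "convergent_prod (\<lambda>i. 1 - a * q ^ i)"
proof (rule abs_convergent_prod_imp_convergent_prod)
  show "abs_convergent_prod (\<lambda>i. 1 - a * q ^ i)"
    unfolding abs_convergent_prod_conv_summable using assms
    by (auto simp: abs_mult power_abs intro!: summable_mult summable_geometric)
qed

lemma LIMSEQ_prod_geometric: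
  assumes "0 \<le> a" "a < 1" "0 \<le> q" "q < (1::real)"
  obtains l where "(\<lambda>N. \<Prod>i<N. 1 - a * q ^ i) \<longlonglongrightarrow> l" "l \<noteq> 0" "l = (\<Prod>i. 1 - a * q ^ i)"
proof -
  have conv: "convergent_prod (\<lambda>i. 1 - a * q ^ i)" by (rule convergent_prod_geometric) (use assms in auto)
  have ne: "1 - a * q ^ i \<noteq> 0" for i
  proof -
    have "a * q ^ i \<le> a * 1" using assms by (intro mult_left_mono power_le_one) auto
    with assms show ?thesis by simp
  qed
  have "(\<lambda>N. \<Prod>i<N. 1 - a * q ^ i) \<longlonglongrightarrow> (\<Prod>i. 1 - a * q ^ i)"
    using convergent_prod_LIMSEQ[OF conv] LIMSEQ_lessThan_iff_atMost[of "\<lambda>A. \<Prod>i\<in>A. 1 - a * q ^ i"] by simp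
  moreover have "(\<Prod>i. 1 - a * q ^ i) \<noteq> 0" using prodinf_nonzero[OF conv] ne by simp
  ultimately show ?thesis using that by blast
qed

definition limc :: real where "limc = (\<Prod>i. 1 - 1/2 * (1/4) ^ i)"

lemma limc_eq: "limc = (\<Prod>i. 1 - 1 / 2 ^ (2 * i + 1))"
proof -
  have "(1::real) - 1/2 * (1/4) ^ i = 1 - 1 / 2 ^ (2 * i + 1)" for i
    by (simp add: power_mult power_divide)
  then show ?thesis by (simp add: limc_def)
qed

lemma eprod_pos: "eprod s > 0"
proof -
  have "(1/4) * (1/4) ^ i < (1::real)" for i
    by (rule le_less_trans[OF mult_left_mono[of "(1/4) ^ i" 1]]) (auto intro: power_le_one)
  then show ?thesis unfolding eprod_def by (intro prod_pos) auto
qed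

text \<open>Lengths \<open>2 * s\<close> split the full product into its odd and even parts, which
  identifies the limit of \<open>qprod\<close>. The value e is never computed: it cancels wherever
  \<open>qprod\<close> is divided by \<open>eprod\<close>.\<close>

lemma prod_limits:
  obtains e where "eprod \<longlonglongrightarrow> e" "e \<noteq> 0" "qprod \<longlonglongrightarrow> limc * e"
proof -
  obtain e where e: "eprod \<longlonglongrightarrow> e" "e \<noteq> 0"
    using LIMSEQ_prod_geometric[of "1/4" "1/4"] unfolding eprod_def by auto
  obtain q where q: "qprod \<longlonglongrightarrow> q"
    using LIMSEQ_prod_geometric[of "1/2" "1/2"] unfolding qprod_def by auto
  have o: "oprod \<longlonglongrightarrow> limc"
    using LIMSEQ_prod_geometric[of "1/2" "1/4"] unfolding oprod_def limc_def by auto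
  have "strict_mono (\<lambda>s::nat. 2 * s)" by (simp add: strict_mono_def)
  from LIMSEQ_subseq_LIMSEQ[OF q this] have "(\<lambda>s. qprod (2 * s)) \<longlonglongrightarrow> q" by (simp add: o_def)
  moreover have "(\<lambda>s. qprod (2 * s)) \<longlonglongrightarrow> limc * e"
    unfolding qprod_double by (intro tendsto_mult o e)
  ultimately have "q = limc * e" by (rule LIMSEQ_unique)
  with e q that show ?thesis by simp
qed

lemma limc_pos: "limc > 0"
proof -
  have "1/2 * (1/4) ^ i < (1::real)" for i
    by (rule le_less_trans[OF mult_left_mono[of "(1/4) ^ i" 1]]) (auto intro: power_le_one)
  then have "oprod s > 0" for s unfolding oprod_def by (intro prod_pos) auto
  then have "0 \<le> oprod s" for s by (simp add: less_imp_le)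
  moreover have "oprod \<longlonglongrightarrow> limc" "limc \<noteq> 0"
    using LIMSEQ_prod_geometric[of "1/2" "1/4"] unfolding oprod_def limc_def by auto
  ultimately show ?thesis using LIMSEQ_le_const[of oprod limc 0] by fastforce
qed

text \<open>Iterating the doubling equation from 1 down to \<open>(1/2) ^ m\<close> produces the
  factors 1 + 2^-i = (1 - 4^-i) / (1 - 2^-i), whose product is \<open>eprod m / qprod m\<close>;
  continuity at 0 finishes. The identity says that the limiting corank weights have total mass
  1.\<close>

lemma wt_series_1: "limc * wt_series 1 = 1"
proof -
  have step: "wt_series 1 * qprod m = eprod m * wt_series ((1/2) ^ m)" for m
  proof (induction m)
    case (Suc m)
    have "wt_series (2 * (1/2) ^ Suc m) = (1 + (1/2) ^ Suc m) * wt_series ((1/2) ^ Suc m)"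
      by (rule wt_series_double) (auto intro: power_le_one)
    then have *: "wt_series ((1/2) ^ m) = (1 + 1/2 * (1/2) ^ m) * wt_series ((1/2) ^ Suc m)" by simp
    have sq: "((1/2) ^ m)\<^sup>2 = (1/4::real) ^ m" by (simp add: power2_eq_square flip: power_mult_distrib)
    have "wt_series 1 * qprod (Suc m) = eprod m * wt_series ((1/2) ^ m) * (1 - 1/2 * (1/2) ^ m)"
      using Suc by (simp add: qprod_def mult.assoc[symmetric])
    also have "\<dots> = eprod m * (1 - 1/4 * ((1/2) ^ m)\<^sup>2) * wt_series ((1/2) ^ Suc m)"
      unfolding * by (simp add: field_simps power2_eq_square)
    also have "\<dots> = eprod (Suc m) * wt_series ((1/2) ^ Suc m)"
      unfolding sq by (simp add: eprod_def)
    finally show ?case .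
  qed (simp add: qprod_def)
  have "isCont wt_series 0"
    using isCont_powser[of wt 1 0] summable_wt_power[of 1] by (simp add: wt_series_def[abs_def])
  then have "(\<lambda>m. wt_series ((1/2) ^ m)) \<longlonglongrightarrow> wt_series 0"
    by (rule isCont_tendsto_compose) (rule LIMSEQ_power_zero, simp)
  moreover have "wt_series 0 = 1" using powser_zero[of wt] by (simp add: wt_series_def)
  ultimately have F: "(\<lambda>m. wt_series ((1/2) ^ m)) \<longlonglongrightarrow> 1" by simp
  obtain e where e: "eprod \<longlonglongrightarrow> e" "e \<noteq> 0" "qprod \<longlonglongrightarrow> limc * e" by (rule prod_limits)
  have "(\<lambda>m. wt_series 1 * qprod m) \<longlonglongrightarrow> wt_series 1 * (limc * e)" by (intro tendsto_intros e)
  moreover have "(\<lambda>m. wt_series 1 * qprod m) \<longlonglongrightarrow> e * 1" unfolding step by (intro tendsto_mult e F)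
  ultimately have "wt_series 1 * (limc * e) = e * 1" by (rule LIMSEQ_unique)
  with e(2) show ?thesis by (simp add: mult.commute[of limc])
qed

text \<open>This is the mass that Z puts on the powers of two; the remaining 1/3 is its atom at
  0.\<close>

lemma wt_series_half: "limc * wt_series (1/2) = 2/3"
proof -
  have "wt_series 1 = 3/2 * wt_series (1/2)" using wt_series_double[of "1/2"] by simp
  with wt_series_1 have "3/2 * (limc * wt_series (1/2)) = 1" by (simp add: mult.left_commute)
  then show ?thesis by simp
qed

text \<open>The classical rank distribution of a uniform symmetric \<open>N\<close> by
  \<open>N\<close> matrix over the field with two elements. The rank is \<open>N - k\<close>, and
  the denominator gains a factor only at each even rank.\<close>

definition corank_prob :: "nat \<Rightarrow> nat \<Rightarrow> real" where
  "corank_prob N k = (if k \<le> N then wt k * qprod N / eprod ((N - k) div 2) else 0)"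

lemma corank_prob_0: "corank_prob 0 k = (if k = 0 then 1 else 0)"
  by (simp add: corank_prob_def qprod_def)

definition inv_eprod :: "nat \<Rightarrow> real" where
  "inv_eprod r = 1 / eprod (r div 2)"

lemma inv_eprod_0_1: "inv_eprod 0 = 1" "inv_eprod (Suc 0) = 1"
  by (simp_all add: inv_eprod_def)

text \<open>With the common factors removed, the corank recursion becomes this second-order
  recursion in the rank. For even r the two terms on the right coincide; for odd r the values at r +
  1 and r + 2 do.\<close>

lemma inv_eprod_rec:
  "(1 - (1/2) ^ (r + 2)) * inv_eprod (r + 2) = (inv_eprod (r + 1) + inv_eprod r) / 2"
proof -
  define s where "s = r div 2"
  have pos: "eprod s > 0" "eprod (Suc s) > 0" by (auto intro: eprod_pos)
  have E: "eprod (Suc s) = eprod s * (1 - 1/4 * (1/4) ^ s)" by (simp add: eprod_def)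
  consider "r = 2 * s" | "r = 2 * s + 1" unfolding s_def by linarith
  then show ?thesis
  proof cases
    case 1
    then have d: "r div 2 = s" "(r + 1) div 2 = s" "(r + 2) div 2 = Suc s" by auto
    have p: "(1/2::real) ^ (r + 2) = 1/4 * (1/4) ^ s" unfolding 1 by (simp add: power_mult power2_eq_square)
    have "(1 - (1/2) ^ (r + 2)) * inv_eprod (r + 2) = 1 / eprod s"
      unfolding inv_eprod_def d p using pos unfolding E by (simp add: field_simps)
    then show ?thesis unfolding inv_eprod_def d by simp
  next
    case 2
    then have d: "r div 2 = s" "(r + 1) div 2 = Suc s" "(r + 2) div 2 = Suc s" by auto
    have p: "(1/2::real) ^ (r + 2) = 1/8 * (1/4) ^ s" unfolding 2 by (simp add: power_mult power2_eq_square)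
    show ?thesis
      unfolding inv_eprod_def d p using pos unfolding E by (simp add: divide_simps) (simp add: algebra_simps)
  qed
qed

text \<open>Once \<open>wt_Suc_mult\<close> has brought all weights to \<open>wt k\<close>, the
  three corank moves become values of \<open>inv_eprod\<close> at the ranks r, r - 1 and r - 2,
  where r is \<open>Suc N\<close> minus k.\<close>

lemma corank_prob_Suc:
  "corank_prob (Suc N) k =
     corank_prob N (Suc k) * (1 - 1 / 2 ^ Suc k) + corank_prob N k / 2 ^ Suc k +
     (if k = 0 then 0 else corank_prob N (k - 1) / 2 ^ k)"
proof -
  \<comment> \<open>Extension by 0 to negative ranks makes the recursion hold at r = 0 and r = 1 as
    well, so impossible coranks need no separate treatment.\<close>
  define g where "g r = (if r \<ge> 0 then inv_eprod (nat r) else 0)" for r :: int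
  have C: "corank_prob M j = wt j * qprod M * g (int M - int j)" for M j
    by (auto simp: corank_prob_def g_def inv_eprod_def nat_minus_as_int)
  have g_rec: "(1 - 1 / 2 ^ nat r) * g r = (g (r - 1) + g (r - 2)) / 2" if r0: "r \<ge> 0" for r
  proof -
    consider "r = 0" | "r = 1" | "r \<ge> 2" using r0 by linarith
    then show ?thesis
    proof cases
      case 3
      define m where "m = nat (r - 2)"
      have "r = int (m + 2)" using 3 by (simp add: m_def)
      then have "nat r = m + 2" "nat (r - 1) = m + 1" "nat (r - 2) = m" "r \<ge> 2" by auto
      then show ?thesis using inv_eprod_rec[of m] by (simp add: g_def power_divide)
    qed (auto simp: g_def inv_eprod_0_1)
  qed
  define x :: real where "x = 1 / 2 ^ k"
  define y :: real where "y = 1 / 2 ^ Suc N"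
  define r where "r = int (Suc N) - int k"
  have w1: "wt (Suc k) * (1 - x / 2) = wt k * (x / 2)"
    using wt_Suc_mult[of k] by (simp add: x_def mult.commute[of 2])
  have w2: "(if k = 0 then 0 else corank_prob N (k - 1) / 2 ^ k) = wt k * (1 - x) * qprod N * g r"
  proof (cases k)
    case (Suc j)
    have "wt j / 2 ^ k = wt k * (1 - x)" using wt_Suc_mult[of j] by (simp add: x_def Suc)
    moreover have "corank_prob N (k - 1) / 2 ^ k = (wt j / 2 ^ k) * qprod N * g r"
      unfolding C r_def by (simp add: Suc)
    ultimately show ?thesis by (simp add: Suc)
  qed (simp add: x_def)
  \<comment> \<open>The factor \<open>1 - y\<close> is the one that \<open>qprod\<close> gains from
    \<open>N\<close> to \<open>Suc N\<close>. As y = x / 2^r, it splits into x (1 - 2^-r) and 1 -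
    x.\<close>
  have key: "(1 - y) * g r = (x / 2) * (g (r - 1) + g (r - 2)) + (1 - x) * g r"
  proof (cases "r \<ge> 0")
    case True
    have y: "y = x * (1 / 2 ^ nat r)"
    proof -
      have "Suc N = k + nat r" using True by (simp add: r_def)
      then show ?thesis unfolding x_def y_def by (simp add: power_add)
    qed
    have "(1 - y) * g r = x * ((1 - 1 / 2 ^ nat r) * g r) + (1 - x) * g r"
      unfolding y by (simp add: algebra_simps)
    then show ?thesis unfolding g_rec[OF True] by simp
  qed (simp add: g_def)
  have "corank_prob (Suc N) k = wt k * qprod N * ((1 - y) * g r)"
    unfolding C r_def by (simp add: qprod_def y_def power_divide)
  also have "\<dots> = wt k * (x / 2) * qprod N * g (r - 2) + wt k * qprod N * g (r - 1) * (x / 2)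
      + wt k * (1 - x) * qprod N * g r"
    unfolding key by (simp add: algebra_simps)
  also have "\<dots> = wt (Suc k) * (1 - x / 2) * qprod N * g (r - 2) + wt k * qprod N * g (r - 1) * (x / 2)
      + wt k * (1 - x) * qprod N * g r"
    unfolding w1 ..
  also have "\<dots> = corank_prob N (Suc k) * (1 - 1 / 2 ^ Suc k) + corank_prob N k / 2 ^ Suc k
      + wt k * (1 - x) * qprod N * g r"
    unfolding C r_def x_def by (simp add: algebra_simps)
  finally show ?thesis unfolding w2 .
qed

lemma corank_prob_LIMSEQ: "(\<lambda>N. corank_prob N k) \<longlonglongrightarrow> limc * wt k"
proof -
  obtain e where e: "eprod \<longlonglongrightarrow> e" "e \<noteq> 0" "qprod \<longlonglongrightarrow> limc * e" by (rule prod_limits)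
  have "filterlim (\<lambda>N. (N - k) div 2) at_top sequentially"
  proof (rule filterlim_at_top[THEN iffD2], rule allI)
    fix Z :: nat
    show "eventually (\<lambda>N. Z \<le> (N - k) div 2) sequentially"
      by (rule eventually_sequentiallyI[of "2 * Z + k"]) linarith
  qed
  then have "(\<lambda>N. eprod ((N - k) div 2)) \<longlonglongrightarrow> e" by (rule filterlim_compose[OF e(1)])
  then have "(\<lambda>N. wt k * qprod N / eprod ((N - k) div 2)) \<longlonglongrightarrow> wt k * (limc * e) / e"
    by (intro tendsto_intros e)
  moreover have "wt k * (limc * e) / e = limc * wt k" using e by simp
  moreover have "eventually (\<lambda>N. wt k * qprod N / eprod ((N - k) div 2) = corank_prob N k) sequentially"
    by (rule eventually_sequentiallyI[of k]) (simp add: corank_prob_def)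
  ultimately show ?thesis using Lim_transform_eventually by fastforce
qed

section \<open>Linear algebra over the field with two elements\<close>

text \<open>By default the simplifier turns \<open>+\<close> and \<open>*\<close> on bits into bitwise operations, out of reach of
  the ring lemmas.\<close>

declare add_bit_eq_xor [simp del] mult_bit_eq_and [simp del]

lemma bit_add_self [simp]: "x + x = (0::bit)"
  by (cases x) simp_all

lemma bit_add_self_left [simp]: "x + (x + y) = (y::bit)"
  by (simp flip: add.assoc)

lemma bit_mult_self [simp]: "x * x = (x::bit)"
  by (cases x) simp_all

lemma bit_add_eq_0_iff: "x + y = 0 \<longleftrightarrow> x = (y::bit)"
  by (cases x; cases y) simp_all

lemma UNIV_bit: "(UNIV :: bit set) = {0, 1}"
  by (auto intro: bit.exhaust)

lemma finite_bit [simp]: "finite (A :: bit set)"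
  by (rule finite_subset[of _ UNIV]) (auto simp: UNIV_bit)

text \<open>Vectors are total functions with value 0 off the index set, so a vector over
  \<open>I\<close> is also one over any larger index set, and kernels before and after bordering can
  be compared as sets.\<close>

definition vec_on :: "'a set \<Rightarrow> ('a \<Rightarrow> bit) set" where
  "vec_on I = {x. \<forall>i. i \<notin> I \<longrightarrow> x i = 0}"

definition symm_on :: "'a set \<Rightarrow> ('a \<Rightarrow> 'a \<Rightarrow> bit) set" where
  "symm_on I = {S. (\<forall>i j. S i j = S j i) \<and> (\<forall>i j. i \<notin> I \<longrightarrow> S i j = 0)}"

definition dot :: "'a set \<Rightarrow> ('a \<Rightarrow> bit) \<Rightarrow> ('a \<Rightarrow> bit) \<Rightarrow> bit" where
  "dot I x y = (\<Sum>i\<in>I. x i * y i)"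

definition mat_vec :: "'a set \<Rightarrow> ('a \<Rightarrow> 'a \<Rightarrow> bit) \<Rightarrow> ('a \<Rightarrow> bit) \<Rightarrow> 'a \<Rightarrow> bit" where
  "mat_vec I S x i = (\<Sum>j\<in>I. S i j * x j)"

definition kern :: "'a set \<Rightarrow> ('a \<Rightarrow> 'a \<Rightarrow> bit) \<Rightarrow> ('a \<Rightarrow> bit) set" where
  "kern I S = {x \<in> vec_on I. \<forall>i. mat_vec I S x i = 0}"

lemma vec_onD: "x \<in> vec_on I \<Longrightarrow> i \<notin> I \<Longrightarrow> x i = 0"
  by (simp add: vec_on_def)

lemma vec_on_add: "x \<in> vec_on I \<Longrightarrow> y \<in> vec_on I \<Longrightarrow> (\<lambda>i. x i + y i) \<in> vec_on I"
  by (simp add: vec_on_def)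

lemma symm_on_commute: "S \<in> symm_on I \<Longrightarrow> S i j = S j i"
  by (simp add: symm_on_def)

lemma symm_on_outside: "S \<in> symm_on I \<Longrightarrow> i \<notin> I \<or> j \<notin> I \<Longrightarrow> S i j = 0"
  by (metis (mono_tags, lifting) mem_Collect_eq symm_on_def)

lemma vec_on_eq_PiE_dflt: "vec_on I = PiE_dflt I 0 (\<lambda>_. UNIV)"
  by (auto simp: vec_on_def PiE_dflt_def)

lemma finite_vec_on [simp]: "finite I \<Longrightarrow> finite (vec_on I)"
  unfolding vec_on_eq_PiE_dflt by (intro finite_PiE_dflt) auto

lemma card_vec_on: "finite I \<Longrightarrow> card (vec_on I) = 2 ^ card I"
  by (simp add: vec_on_eq_PiE_dflt card_PiE_dflt UNIV_bit numeral_2_eq_2)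

lemma finite_kern [simp]: "finite I \<Longrightarrow> finite (kern I S)"
  by (simp add: kern_def)

lemma zero_in_kern: "(\<lambda>_. 0) \<in> kern I S"
  by (simp add: kern_def vec_on_def mat_vec_def)

lemma card_kern_pos: "finite I \<Longrightarrow> card (kern I S) > 0"
  using zero_in_kern[of I S] card_gt_0_iff finite_kern by blast

lemma mat_vec_add: "mat_vec I S (\<lambda>i. x i + y i) i = mat_vec I S x i + mat_vec I S y i"
  by (simp add: mat_vec_def algebra_simps sum.distrib)

lemma kern_add: "x \<in> kern I S \<Longrightarrow> y \<in> kern I S \<Longrightarrow> (\<lambda>i. x i + y i) \<in> kern I S"
  by (simp add: kern_def vec_on_add mat_vec_add)

lemma dot_add_right: "dot I x (\<lambda>i. y i + z i) = dot I x y + dot I x z"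
  by (simp add: dot_def algebra_simps sum.distrib)

lemma dot_add_left: "dot I (\<lambda>i. y i + z i) x = dot I y x + dot I z x"
  by (simp add: dot_def algebra_simps sum.distrib)

lemma dot_mat_vec:
  assumes "S \<in> symm_on I"
  shows "dot I (mat_vec I S x) y = dot I x (mat_vec I S y)"
proof -
  have "dot I (mat_vec I S x) y = (\<Sum>i\<in>I. \<Sum>j\<in>I. S i j * x j * y i)"
    by (simp add: dot_def mat_vec_def sum_distrib_right)
  also have "\<dots> = (\<Sum>j\<in>I. \<Sum>i\<in>I. S i j * x j * y i)" by (rule sum.swap)
  also have "\<dots> = (\<Sum>j\<in>I. \<Sum>i\<in>I. x j * (S j i * y i))"
    using symm_on_commute[OF assms] by (intro sum.cong refl) (simp add: ac_simps)
  also have "\<dots> = dot I x (mat_vec I S y)"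
    by (simp add: dot_def mat_vec_def sum_distrib_left)
  finally show ?thesis .
qed

section \<open>Character sums, and duality between range and kernel\<close>

definition sign :: "bit \<Rightarrow> int" where
  "sign b = (if b = 0 then 1 else - 1)"

lemma sign_add: "sign (a + b) = sign a * sign b"
  by (cases a; cases b) (simp_all add: sign_def)

text \<open>Translation by a member permutes a set closed under addition. If it flips the sign of
  every summand, the sum equals its own negative and vanishes.\<close>

lemma sum_translate:
  fixes W :: "('a \<Rightarrow> bit) set"
  assumes "w0 \<in> W" "\<And>x y. x \<in> W \<Longrightarrow> y \<in> W \<Longrightarrow> (\<lambda>i. x i + y i) \<in> W"
  shows "(\<Sum>w\<in>W. f (\<lambda>i. w i + w0 i)) = (\<Sum>w\<in>W. f w)"
  by (rule sum.reindex_bij_witness[of _ "\<lambda>w i. w i + w0 i" "\<lambda>w i. w i + w0 i"])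
     (use assms in \<open>auto simp: add.assoc\<close>)

text \<open>Count \<open>\<Sum>w\<in>W. \<Sum>b. (-1) ^ (b \<bullet> w)\<close> in both orders.\<close>

lemma card_annihilator:
  assumes I: "finite I" and W: "W \<subseteq> vec_on I" "(\<lambda>_. 0) \<in> W"
    and add: "\<And>x y. x \<in> W \<Longrightarrow> y \<in> W \<Longrightarrow> (\<lambda>i. x i + y i) \<in> W"
  shows "card W * card {b \<in> vec_on I. \<forall>w\<in>W. dot I b w = 0} = 2 ^ card I"
proof -
  let ?V = "vec_on I" and ?A = "{b \<in> vec_on I. \<forall>w\<in>W. dot I b w = 0}"
  have finW: "finite W" using W(1) I finite_subset finite_vec_on by blast
  have 1: "(\<Sum>w\<in>W. sign (dot I b w)) = (if b \<in> ?A then int (card W) else 0)" if "b \<in> ?V" for b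
  proof (cases "b \<in> ?A")
    case True
    then have "(\<Sum>w\<in>W. sign (dot I b w)) = (\<Sum>w\<in>W. 1)"
      by (intro sum.cong) (auto simp: sign_def)
    with True show ?thesis by simp
  next
    case False
    with that obtain w0 where w0: "w0 \<in> W" "dot I b w0 = 1" by auto
    have "(\<Sum>w\<in>W. sign (dot I b w)) = (\<Sum>w\<in>W. sign (dot I b (\<lambda>i. w i + w0 i)))"
      by (rule sum_translate[OF w0(1) add, symmetric])
    also have "\<dots> = - (\<Sum>w\<in>W. sign (dot I b w))"
      using w0(2) by (simp add: dot_add_right sign_add sum_negf) (simp add: sign_def sum_negf)
    finally show ?thesis using False by auto
  qed
  have 2: "(\<Sum>b\<in>?V. sign (dot I b w)) = (if w = (\<lambda>_. 0) then int (card ?V) else 0)" if "w \<in> W" for w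
  proof (cases "w = (\<lambda>_. 0)")
    case True
    then show ?thesis by (simp add: sign_def dot_def)
  next
    case False
    then obtain i where i: "w i = 1" by (auto simp: fun_eq_iff)
    with that W(1) have "i \<in> I" by (metis subsetD vec_onD zero_neq_one)
    define e where "e = (\<lambda>j. of_bool (j = i) :: bit)"
    have e: "e \<in> ?V" using \<open>i \<in> I\<close> by (auto simp: e_def vec_on_def)
    have "dot I e w = (\<Sum>j\<in>I. if j = i then 1 else 0)" unfolding dot_def e_def
      by (intro sum.cong) (auto simp: i)
    then have "dot I e w = 1" using \<open>i \<in> I\<close> I by simp
    have "(\<Sum>b\<in>?V. sign (dot I b w)) = (\<Sum>b\<in>?V. sign (dot I (\<lambda>i. b i + e i) w))"
      by (rule sum_translate[OF e vec_on_add, symmetric])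
    also have "\<dots> = - (\<Sum>b\<in>?V. sign (dot I b w))"
      using \<open>dot I e w = 1\<close> by (simp add: dot_add_left sign_add sum_negf) (simp add: sign_def sum_negf)
    finally show ?thesis using False by auto
  qed
  have "int (card W * card ?A) = (\<Sum>b\<in>?V. if b \<in> ?A then int (card W) else 0)"
    using I by (simp add: sum.If_cases Int_absorb1 Collect_conj_eq flip: Int_def)
  also have "\<dots> = (\<Sum>b\<in>?V. \<Sum>w\<in>W. sign (dot I b w))" using 1 by simp
  also have "\<dots> = (\<Sum>w\<in>W. \<Sum>b\<in>?V. sign (dot I b w))" by (rule sum.swap)
  also have "\<dots> = (\<Sum>w\<in>W. if w = (\<lambda>_. 0) then int (card ?V) else 0)" using 2 by simp
  also have "\<dots> = int (card ?V)" using finW W(2) by simp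
  finally show ?thesis using I by (simp only: card_vec_on of_nat_eq_iff)
qed

lemma card_fibre:
  assumes "finite I" "x0 \<in> vec_on I"
  shows "card {x \<in> vec_on I. mat_vec I S x = mat_vec I S x0} = card (kern I S)"
proof (rule bij_betw_same_card, rule bij_betw_byWitness[where f' = "\<lambda>x i. x i + x0 i"])
  let ?t = "\<lambda>x i. x i + x0 i" and ?F = "{x \<in> vec_on I. mat_vec I S x = mat_vec I S x0}"
  show "\<forall>x\<in>?F. ?t (?t x) = x" "\<forall>x\<in>kern I S. ?t (?t x) = x" by (simp_all add: add.assoc)
  show "?t ` ?F \<subseteq> kern I S"
    using assms(2) by (auto simp: kern_def vec_on_add mat_vec_add)
  show "?t ` kern I S \<subseteq> ?F"
    using assms(2) by (auto simp: kern_def vec_on_add mat_vec_add fun_eq_iff)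
qed

text \<open>Rank-nullity in multiplicative form: every nonempty fibre is a translate of the
  kernel.\<close>

lemma card_range:
  assumes "finite I"
  shows "card (mat_vec I S ` vec_on I) * card (kern I S) = 2 ^ card I"
proof -
  have "2 ^ card I = (\<Sum>x\<in>vec_on I. 1::nat)" using assms by (simp add: card_vec_on)
  also have "\<dots> = (\<Sum>y\<in>mat_vec I S ` vec_on I. \<Sum>x\<in>{x \<in> vec_on I. mat_vec I S x = y}. 1)"
    using assms by (intro sum.image_gen) simp
  also have "\<dots> = (\<Sum>y\<in>mat_vec I S ` vec_on I. card (kern I S))"
    using card_fibre[OF assms] by (intro sum.cong) auto
  finally show ?thesis by simp
qed

text \<open>Self-adjointness gives one inclusion. Both sides have
  \<open>2 ^ card I / card (kern I S)\<close> elements, by \<open>card_range\<close> and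
  \<open>card_annihilator\<close>, so counting replaces any argument with bases.\<close>

lemma range_eq_annihilator:
  assumes "finite I" "S \<in> symm_on I"
  shows "mat_vec I S ` vec_on I = {b \<in> vec_on I. \<forall>w\<in>kern I S. dot I b w = 0}" (is "?R = ?A")
proof (rule card_subset_eq)
  have "kern I S \<subseteq> vec_on I" by (auto simp: kern_def)
  then have "card (kern I S) * card ?A = 2 ^ card I"
    by (intro card_annihilator assms zero_in_kern kern_add)
  then have "card (kern I S) * card ?R = card (kern I S) * card ?A"
    using card_range[OF assms(1), of S] by (simp add: mult.commute)
  then show "card ?R = card ?A" using card_kern_pos[OF assms(1), of S] by simp
  show "finite ?A" using assms(1) by simp
  show "?R \<subseteq> ?A"
  proof (intro subsetI CollectI conjI ballI)
    fix b assume "b \<in> ?R"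
    then obtain x where x: "b = mat_vec I S x" by auto
    show "b \<in> vec_on I"
      unfolding x using symm_on_outside[OF assms(2)] by (auto simp: vec_on_def mat_vec_def)
    fix w assume "w \<in> kern I S"
    then have "mat_vec I S w = (\<lambda>_. 0)" by (auto simp: kern_def)
    then show "dot I b w = 0"
      unfolding x dot_mat_vec[OF assms(2)] by (simp add: dot_def)
  qed
qed

lemma sum_symmetric_bit:
  fixes T :: "'a \<Rightarrow> 'a \<Rightarrow> bit"
  assumes "finite I" "\<And>i j. T i j = T j i"
  shows "(\<Sum>i\<in>I. \<Sum>j\<in>I. T i j) = (\<Sum>i\<in>I. T i i)"
  using assms(1)
proof induction
  case (insert a I)
  have "(\<Sum>i\<in>insert a I. \<Sum>j\<in>insert a I. T i j) =
      T a a + (\<Sum>j\<in>I. T a j) + ((\<Sum>i\<in>I. T i a) + (\<Sum>i\<in>I. \<Sum>j\<in>I. T i j))"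
    using insert.hyps by (simp add: sum.distrib)
  also have "(\<Sum>i\<in>I. T i a) = (\<Sum>j\<in>I. T a j)" using assms(2) by simp
  finally show ?case using insert by (simp add: add.assoc)
qed simp

text \<open>For w in the kernel, the off-diagonal terms of the quadratic form of \<open>S\<close> at
  w cancel in pairs, and \<open>w i * w i = w i\<close>. So the diagonal paired with w is the value
  of that form, which is 0; duality then puts the diagonal into the range.\<close>

lemma diag_in_range:
  assumes "finite I" "S \<in> symm_on I"
  shows "(\<lambda>i. S i i) \<in> mat_vec I S ` vec_on I"
  unfolding range_eq_annihilator[OF assms]
proof (intro CollectI conjI ballI)
  show "(\<lambda>i. S i i) \<in> vec_on I" using symm_on_outside[OF assms(2)] by (auto simp: vec_on_def)
  fix w assume w: "w \<in> kern I S"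
  have "dot I (\<lambda>i. S i i) w = (\<Sum>i\<in>I. w i * (S i i * w i))"
    unfolding dot_def by (intro sum.cong refl) (simp add: ac_simps flip: mult.assoc)
  also have "\<dots> = (\<Sum>i\<in>I. \<Sum>j\<in>I. w i * (S i j * w j))"
    by (rule sum_symmetric_bit[OF assms(1), symmetric])
       (metis symm_on_commute[OF assms(2)] mult.commute mult.left_commute)
  also have "\<dots> = dot I w (mat_vec I S w)"
    by (simp add: dot_def mat_vec_def sum_distrib_left)
  also have "\<dots> = 0" using w by (simp add: kern_def dot_def)
  finally show "dot I (\<lambda>i. S i i) w = 0" .
qed

lemma card_solutions:
  assumes "finite I" "S \<in> symm_on I" "y \<in> vec_on I"
  shows "card {x \<in> vec_on I. mat_vec I S x = y} =
    (if \<forall>w\<in>kern I S. dot I y w = 0 then card (kern I S) else 0)"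
proof (cases "\<forall>w\<in>kern I S. dot I y w = 0")
  case True
  then have "y \<in> mat_vec I S ` vec_on I" using range_eq_annihilator[OF assms(1,2)] assms(3) by simp
  then obtain x0 where "x0 \<in> vec_on I" "y = mat_vec I S x0" by auto
  with True show ?thesis using card_fibre[OF assms(1)] by simp
next
  case False
  then have "y \<notin> mat_vec I S ` vec_on I" using range_eq_annihilator[OF assms(1,2)] by simp
  then have empty: "{x \<in> vec_on I. mat_vec I S x = y} = {}" by auto
  from False show ?thesis unfolding empty by (simp only: if_False card.empty)
qed

section \<open>Bordered symmetric matrices\<close>

definition border :: "'a \<Rightarrow> ('a \<Rightarrow> 'a \<Rightarrow> bit) \<Rightarrow> ('a \<Rightarrow> bit) \<Rightarrow> bit \<Rightarrow> 'a \<Rightarrow> 'a \<Rightarrow> bit" where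
  "border a S b d =
     (\<lambda>i j. if i = a then (if j = a then d else b j) else if j = a then b i else S i j)"

lemma bij_betw_border:
  assumes "a \<notin> I"
  shows "bij_betw (\<lambda>(S, b, d). border a S b d) (symm_on I \<times> vec_on I \<times> UNIV) (symm_on (insert a I))"
proof (rule bij_betw_byWitness[where f' = "\<lambda>S. ((\<lambda>i j. if i = a \<or> j = a then 0 else S i j),
      (\<lambda>i. if i = a then 0 else S i a), S a a)"])
  show "\<forall>x\<in>symm_on I \<times> vec_on I \<times> UNIV.
      (\<lambda>S. ((\<lambda>i j. if i = a \<or> j = a then 0 else S i j), (\<lambda>i. if i = a then 0 else S i a), S a a))
       (case x of (S, b, d) \<Rightarrow> border a S b d) = x"
    using assms by (auto simp: border_def fun_eq_iff symm_on_outside vec_onD)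
  show "\<forall>S\<in>symm_on (insert a I).
      (case ((\<lambda>i j. if i = a \<or> j = a then 0 else S i j), (\<lambda>i. if i = a then 0 else S i a), S a a)
       of (S, b, d) \<Rightarrow> border a S b d) = S"
    by (auto simp: border_def fun_eq_iff intro: symm_on_commute)
  show "(\<lambda>(S, b, d). border a S b d) ` (symm_on I \<times> vec_on I \<times> UNIV) \<subseteq> symm_on (insert a I)"
    by (auto simp: border_def symm_on_def vec_on_def)
  show "(\<lambda>S. ((\<lambda>i j. if i = a \<or> j = a then 0 else S i j), (\<lambda>i. if i = a then 0 else S i a), S a a)) `
      symm_on (insert a I) \<subseteq> symm_on I \<times> vec_on I \<times> UNIV"
    by (auto simp: symm_on_def vec_on_def)
qed

lemma sum_symm_on_insert:
  assumes "a \<notin> I"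
  shows "(\<Sum>S\<in>symm_on (insert a I). f S) =
    (\<Sum>S\<in>symm_on I. \<Sum>b\<in>vec_on I. \<Sum>d\<in>UNIV. f (border a S b d))"
  using sum.reindex_bij_betw[OF bij_betw_border[OF assms], of f]
  by (simp add: sum.cartesian_product split_def)

lemma symm_on_empty: "symm_on {} = {\<lambda>_ _. 0}"
  by (auto simp: symm_on_def fun_eq_iff)

lemma finite_card_symm_on:
  assumes "finite I"
  shows "finite (symm_on I) \<and> card (symm_on I) = 2 ^ (Suc (card I) choose 2)"
  using assms
proof induction
  case (insert a I)
  note bij = bij_betw_border[OF insert.hyps(2)]
  have "finite (symm_on (insert a I))"
    using bij_betw_finite[OF bij] insert by simp
  moreover have "card (symm_on (insert a I)) = card (symm_on I) * (2 ^ card I * 2)"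
    using bij_betw_same_card[OF bij] insert.hyps
    by (simp add: card_cartesian_product card_vec_on UNIV_bit mult_2_right)
  moreover have "Suc (Suc (card I)) choose 2 = Suc (card I) + (Suc (card I) choose 2)"
    by (simp add: numeral_2_eq_2)
  ultimately show ?case using insert by (simp add: power_add)
qed (simp add: symm_on_empty numeral_2_eq_2)

lemmas finite_symm_on [simp] = finite_card_symm_on[THEN conjunct1]
lemmas card_symm_on = finite_card_symm_on[THEN conjunct2]

lemma symm_on_nonempty [simp]: "symm_on I \<noteq> {}"
proof -
  have "(\<lambda>_ _. 0) \<in> symm_on I" by (simp add: symm_on_def)
  then show ?thesis by blast
qed

lemma mat_vec_border:
  assumes "finite I" "a \<notin> I"
  shows "mat_vec (insert a I) (border a S b d) z i =
    (if i = a then d * z a + dot I b z else b i * z a + mat_vec I S z i)"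
proof -
  have "(\<Sum>j\<in>I. border a S b d i j * z j) = (\<Sum>j\<in>I. (if i = a then b j else S i j) * z j)"
    using assms(2) by (intro sum.cong) (auto simp: border_def)
  then show ?thesis using assms
    by (simp add: mat_vec_def dot_def) (simp add: border_def)
qed

lemma sum_fun_upd_outside:
  assumes "a \<notin> I"
  shows "mat_vec I S (x(a := t)) = mat_vec I S x" "dot I b (x(a := t)) = dot I b x"
proof -
  have "(\<Sum>j\<in>I. c j * (x(a := t)) j) = (\<Sum>j\<in>I. c j * x j)" for c
    using assms by (intro sum.cong) auto
  then show "mat_vec I S (x(a := t)) = mat_vec I S x" "dot I b (x(a := t)) = dot I b x"
    by (simp_all add: mat_vec_def[abs_def] dot_def)
qed

text \<open>The two parts are the kernel vectors with \<open>a\<close>-coordinate 0 and 1.\<close>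

lemma kern_border:
  assumes I: "finite I" "a \<notin> I" and S: "S \<in> symm_on I" and b: "b \<in> vec_on I"
  shows "kern (insert a I) (border a S b d) =
    {x \<in> kern I S. dot I b x = 0} \<union>
    (\<lambda>x. x(a := 1)) ` {x \<in> vec_on I. mat_vec I S x = b \<and> dot I b x = d}" (is "?K = ?Z0 \<union> ?u ` ?Z1")
proof (intro equalityI subsetI)
  have out: "mat_vec I S z a = 0" "b a = 0" for z
    using symm_on_outside[OF S] I(2) b by (auto simp: mat_vec_def vec_onD)
  fix z assume z: "z \<in> ?K"
  then have zv: "z i = 0" if "i \<notin> insert a I" for i using that by (auto simp: kern_def vec_on_def)
  from z have eq: "d * z a + dot I b z = 0" "\<And>i. i \<noteq> a \<Longrightarrow> b i * z a + mat_vec I S z i = 0"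
    by (auto simp: kern_def mat_vec_border[OF I] split: if_splits)
  show "z \<in> ?Z0 \<union> ?u ` ?Z1"
  proof (cases "z a = 0")
    case True
    then have "mat_vec I S z i = 0" for i using eq(2)[of i] out by (cases "i = a") auto
    then have "z \<in> ?Z0" using True eq(1) zv by (fastforce simp: kern_def vec_on_def)
    then show ?thesis ..
  next
    case False
    then have 1: "z a = 1" by simp
    define x where "x = z(a := 0)"
    have "x \<in> vec_on I" using zv by (auto simp: x_def vec_on_def)
    moreover have "mat_vec I S x = b"
    proof
      fix i show "mat_vec I S x i = b i"
        using eq(2)[of i] out 1 I(2)
        by (cases "i = a") (auto simp: x_def sum_fun_upd_outside bit_add_eq_0_iff)
    qed
    moreover have "dot I b x = d"
      using eq(1) 1 I(2) by (auto simp: x_def sum_fun_upd_outside bit_add_eq_0_iff)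
    moreover have "z = ?u x" using 1 by (auto simp: x_def)
    ultimately show ?thesis by blast
  qed
next
  fix z assume "z \<in> ?Z0 \<union> ?u ` ?Z1"
  then show "z \<in> ?K"
  proof
    assume z: "z \<in> ?Z0"
    then have "z a = 0" using I(2) by (auto simp: kern_def vec_on_def)
    with z show ?thesis by (auto simp: kern_def vec_on_def mat_vec_border[OF I])
  next
    assume "z \<in> ?u ` ?Z1"
    then obtain x where x: "z = ?u x" "x \<in> vec_on I" "mat_vec I S x = b" "dot I b x = d" by auto
    then have "z \<in> vec_on (insert a I)" by (auto simp: vec_on_def)
    with x I(2) show ?thesis
      by (auto simp: kern_def mat_vec_border[OF I] sum_fun_upd_outside)
  qed
qed

text \<open>For symmetric \<open>S\<close> and \<open>a\<close> in a finite \<open>I\<close> this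
  says, by duality, that the unit vector at \<open>a\<close> lies in the range of
  \<open>S\<close>.\<close>

definition vanish_at :: "'a \<Rightarrow> 'a set \<Rightarrow> ('a \<Rightarrow> 'a \<Rightarrow> bit) \<Rightarrow> bool" where
  "vanish_at a I S \<longleftrightarrow> (\<forall>z\<in>kern I S. z a = 0)"

lemma kern_border_cases:
  fixes d :: bit
  assumes I: "finite I" "a \<notin> I" and S: "S \<in> symm_on I" and b: "b \<in> vec_on I"
  defines "Z0 \<equiv> {x \<in> kern I S. dot I b x = 0}"
    and "Z1 \<equiv> {x \<in> vec_on I. mat_vec I S x = b \<and> dot I b x = d}"
  shows "card (kern (insert a I) (border a S b d)) = card Z0 + card Z1"
    and "vanish_at a (insert a I) (border a S b d) \<longleftrightarrow> Z1 = {}"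
proof -
  have 0: "z a = 0" if "z \<in> Z0" for z using that I(2) by (auto simp: Z0_def kern_def vec_on_def)
  have K: "kern (insert a I) (border a S b d) = Z0 \<union> (\<lambda>x. x(a := 1)) ` Z1"
    unfolding Z0_def Z1_def by (rule kern_border[OF I S b])
  have "inj_on (\<lambda>x. x(a := 1)) Z1"
  proof (rule inj_onI)
    fix x y assume xy: "x \<in> Z1" "y \<in> Z1" "x(a := 1) = y(a := 1)"
    then have "x a = y a" using I(2) by (auto simp: Z1_def vec_on_def)
    with xy(3) show "x = y" by (metis fun_upd_triv fun_upd_upd)
  qed
  moreover have "Z0 \<inter> (\<lambda>x. x(a := 1)) ` Z1 = {}" using 0 by fastforce
  moreover have "finite Z0" "finite Z1" using I(1) by (auto simp: Z0_def Z1_def)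
  ultimately show "card (kern (insert a I) (border a S b d)) = card Z0 + card Z1"
    unfolding K by (simp add: card_Un_disjoint card_image)
  show "vanish_at a (insert a I) (border a S b d) \<longleftrightarrow> Z1 = {}"
    unfolding vanish_at_def K using 0 by (auto simp: ball_Un)
qed

text \<open>By duality b is a nonzero functional on the kernel of \<open>S\<close>, so it kills
  exactly half of it. A kernel vector with \<open>a\<close>-coordinate 1 would solve
  \<open>mat_vec I S x = b\<close>, which is impossible.\<close>

lemma kern_border_notin_range:
  assumes I: "finite I" "a \<notin> I" and S: "S \<in> symm_on I" and b: "b \<in> vec_on I"
    and nr: "b \<notin> mat_vec I S ` vec_on I"
  shows "2 * card (kern (insert a I) (border a S b d)) = card (kern I S)"
    and "vanish_at a (insert a I) (border a S b d)"
proof -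
  let ?Z0 = "{x \<in> kern I S. dot I b x = 0}" and ?N = "{x \<in> kern I S. dot I b x = 1}"
  have empty: "{x \<in> vec_on I. mat_vec I S x = b \<and> dot I b x = d} = {}" using nr by auto
  obtain w0 where w0: "w0 \<in> kern I S" "dot I b w0 = 1"
    using nr b unfolding range_eq_annihilator[OF I(1) S] by auto
  have "card ?Z0 = card ?N"
    by (rule bij_betw_same_card, rule bij_betw_byWitness[where f' = "\<lambda>x i. x i + w0 i" and f = "\<lambda>x i. x i + w0 i"])
       (use w0 kern_add[of _ I S w0] in \<open>auto simp: add.assoc dot_add_right\<close>)
  moreover have "card (kern I S) = card ?Z0 + card ?N"
    by (subst card_Un_disjoint[symmetric]) (use I(1) in \<open>auto intro: arg_cong[where f = card]\<close>)
  ultimately show "2 * card (kern (insert a I) (border a S b d)) = card (kern I S)"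
    unfolding kern_border_cases(1)[OF I S b] empty by simp
  show "vanish_at a (insert a I) (border a S b d)"
    unfolding kern_border_cases(2)[OF I S b] by (rule empty)
qed

text \<open>Now b annihilates the kernel, so the whole kernel survives, and \<open>dot I b x\<close>
  is the same for all solutions of \<open>mat_vec I S x = b\<close>. Exactly one corner entry d
  therefore admits kernel vectors with \<open>a\<close>-coordinate 1, and there are as many of these
  as the kernel of \<open>S\<close> has elements.\<close>

lemma kern_border_in_range:
  assumes I: "finite I" "a \<notin> I" and S: "S \<in> symm_on I" and x0: "x0 \<in> vec_on I"
  defines "b \<equiv> mat_vec I S x0"
  shows "card (kern (insert a I) (border a S b d)) =
      (if d = dot I b x0 then 2 * card (kern I S) else card (kern I S))"
    and "vanish_at a (insert a I) (border a S b d) \<longleftrightarrow> d \<noteq> dot I b x0"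
proof -
  have b: "b \<in> vec_on I" unfolding b_def using range_eq_annihilator[OF I(1) S] x0 by auto
  have ann: "dot I b w = 0" if "w \<in> kern I S" for w
    using range_eq_annihilator[OF I(1) S] x0 that unfolding b_def by auto
  then have Z0: "{x \<in> kern I S. dot I b x = 0} = kern I S" by auto
  have "dot I b x = dot I b x0" if "x \<in> vec_on I" "mat_vec I S x = b" for x
  proof -
    have "(\<lambda>i. x i + x0 i) \<in> kern I S"
      using that x0 by (simp add: kern_def vec_on_add mat_vec_add b_def)
    from ann[OF this] show ?thesis by (simp add: dot_add_right bit_add_eq_0_iff)
  qed
  then have Z1: "{x \<in> vec_on I. mat_vec I S x = b \<and> dot I b x = d} =
      (if d = dot I b x0 then {x \<in> vec_on I. mat_vec I S x = mat_vec I S x0} else {})"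
    by (auto simp: b_def)
  show "card (kern (insert a I) (border a S b d)) =
      (if d = dot I b x0 then 2 * card (kern I S) else card (kern I S))"
    unfolding kern_border_cases(1)[OF I S b] Z0 Z1 by (simp add: card_fibre[OF I(1) x0])
  show "vanish_at a (insert a I) (border a S b d) \<longleftrightarrow> d \<noteq> dot I b x0"
    unfolding kern_border_cases(2)[OF I S b] Z1 using x0 by auto
qed

lemma sum_UNIV_bit: "(\<Sum>d\<in>UNIV. f d) = f t + f (t + 1 :: bit)"
  by (cases t) (auto simp: UNIV_bit add.commute)

text \<open>Of the \<open>M\<close> vectors b a share 1 / w lies in the range. Outside it both
  corner entries halve the kernel; inside it one keeps the size and the other doubles it. A general
  \<open>F\<close> covers every joint statistic of size and vanishing at once.\<close>

lemma sum_border: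
  fixes F :: "nat \<Rightarrow> bool \<Rightarrow> real"
  assumes I: "finite I" "a \<notin> I" and S: "S \<in> symm_on I"
  defines "w \<equiv> card (kern I S)" and "M \<equiv> 2 ^ card I"
    and "G \<equiv> \<lambda>S. F (card (kern (insert a I) S)) (vanish_at a (insert a I) S)"
  shows "(\<Sum>b\<in>vec_on I. \<Sum>d\<in>UNIV. G (border a S b d)) =
    2 * (M - M / w) * F (w div 2) True + M / w * (F w True + F (2 * w) False)"
proof -
  let ?R = "mat_vec I S ` vec_on I"
  have 1: "(\<Sum>d\<in>UNIV. G (border a S b d)) = 2 * F (w div 2) True" if "b \<in> vec_on I" "b \<notin> ?R" for b
  proof -
    have "card (kern (insert a I) (border a S b d)) = w div 2" for d
      using kern_border_notin_range(1)[OF I S that, of d] unfolding w_def by presburger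
    then show ?thesis using kern_border_notin_range(2)[OF I S that] by (simp add: G_def UNIV_bit)
  qed
  have 2: "(\<Sum>d\<in>UNIV. G (border a S b d)) = F w True + F (2 * w) False" if "b \<in> ?R" for b
  proof -
    from that obtain x0 where x0: "x0 \<in> vec_on I" "b = mat_vec I S x0" by auto
    show ?thesis unfolding sum_UNIV_bit[where t = "dot I b x0"] G_def x0(2)
        kern_border_in_range[OF I S x0(1)] by (simp add: w_def)
  qed
  have sub: "?R \<subseteq> vec_on I" using range_eq_annihilator[OF I(1) S] by auto
  have R: "real (card ?R) = M / w"
  proof -
    have "real (card ?R) * real w = M"
      using card_range[OF I(1), of S] unfolding w_def M_def
      by (metis of_nat_mult of_nat_numeral of_nat_power)
    moreover have "w > 0" unfolding w_def by (rule card_kern_pos[OF I(1)])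
    ultimately show ?thesis by (simp add: field_simps)
  qed
  have "real (card (vec_on I - ?R)) = M - M / w"
  proof -
    have "card (vec_on I) = card (vec_on I - ?R) + card ?R"
      using card_Diff_subset[OF finite_subset[OF sub finite_vec_on[OF I(1)]] sub]
        card_mono[OF finite_vec_on[OF I(1)] sub] by simp
    then have "real (card (vec_on I)) = real (card (vec_on I - ?R)) + M / w"
      using R by linarith
    then show ?thesis by (simp add: card_vec_on[OF I(1)] M_def)
  qed
  moreover have "(\<Sum>b\<in>vec_on I. \<Sum>d\<in>UNIV. G (border a S b d)) =
      (\<Sum>b\<in>vec_on I - ?R. 2 * F (w div 2) True) + (\<Sum>b\<in>?R. F w True + F (2 * w) False)"
    using 1 2 by (subst sum.subset_diff[OF sub finite_vec_on[OF I(1)]]) simp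
  ultimately have "(\<Sum>b\<in>vec_on I. \<Sum>d\<in>UNIV. G (border a S b d)) =
      (M - M / w) * (2 * F (w div 2) True) + M / w * (F w True + F (2 * w) False)"
    by (simp only: sum_constant R)
  then show ?thesis by simp
qed

section \<open>Limit laws\<close>

definition symm_prob :: "'a set \<Rightarrow> (('a \<Rightarrow> 'a \<Rightarrow> bit) \<Rightarrow> bool) \<Rightarrow> real" where
  "symm_prob I P = card {S \<in> symm_on I. P S} / card (symm_on I)"

lemma card_kern_power:
  assumes "finite I"
  obtains m where "card (kern I S) = 2 ^ m"
proof -
  have "card (kern I S) dvd 2 ^ card I"
    using card_range[OF assms, of S] by (metis dvd_triv_right)
  with that show ?thesis using divides_primepow_nat[of 2] two_is_prime_nat by blast
qed

lemma real_card_Collect: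
  "finite A \<Longrightarrow> real (card {x \<in> A. P x}) = (\<Sum>x\<in>A. of_bool (P x))"
  by (simp add: of_bool_def sum.If_cases Int_def)

text \<open>Kernels vanishing at the new coordinate arise by halving one of exponent k + 1 or
  keeping one of exponent k; the others arise only by doubling one of exponent k - 1, hence never
  have exponent 0.\<close>

lemma symm_prob_insert:
  assumes I: "finite I" "a \<notin> I"
  shows "symm_prob (insert a I) (\<lambda>S. card (kern (insert a I) S) = 2 ^ k \<and> vanish_at a (insert a I) S) =
      symm_prob I (\<lambda>S. card (kern I S) = 2 ^ Suc k) * (1 - 1 / 2 ^ Suc k)
      + symm_prob I (\<lambda>S. card (kern I S) = 2 ^ k) / 2 ^ Suc k" (is "symm_prob _ ?P = _")
    and "symm_prob (insert a I) (\<lambda>S. card (kern (insert a I) S) = 2 ^ k \<and> \<not> vanish_at a (insert a I) S) =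
      (if k = 0 then 0 else symm_prob I (\<lambda>S. card (kern I S) = 2 ^ (k - 1)) / 2 ^ k)" (is "symm_prob _ ?N = _")
proof -
  define M :: real where "M = 2 ^ card I"
  define C where "C = real (card (symm_on I))"
  define p where "p j = symm_prob I (\<lambda>S. card (kern I S) = 2 ^ j)" for j
  have M: "M > 0" and C: "C > 0" using I by (auto simp: M_def C_def card_gt_0_iff)
  have p: "(\<Sum>S\<in>symm_on I. of_bool (card (kern I S) = 2 ^ j)) = C * p j" for j
    using C unfolding p_def symm_prob_def C_def
    by (simp add: real_card_Collect[OF finite_symm_on[OF I(1)]])
  have C': "real (card (symm_on (insert a I))) = 2 * M * C"
  proof -
    have "real (card (symm_on (insert a I))) = (\<Sum>S\<in>symm_on (insert a I). 1)" by simp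
    also have "\<dots> = 2 * M * C"
      unfolding sum_symm_on_insert[OF I(2)] using I(1)
      by (simp add: card_vec_on M_def C_def UNIV_bit)
    finally show ?thesis .
  qed
  let ?G = "\<lambda>F S. F (card (kern (insert a I) S)) (vanish_at a (insert a I) S) :: real"
  have sum: "(\<Sum>S\<in>symm_on (insert a I). ?G F S) =
      (\<Sum>S\<in>symm_on I. 2 * (M - M / card (kern I S)) * F (card (kern I S) div 2) True
        + M / card (kern I S) * (F (card (kern I S)) True + F (2 * card (kern I S)) False))" for F
    unfolding sum_symm_on_insert[OF I(2)] M_def by (intro sum.cong refl sum_border I)
  have fin: "finite (symm_on (insert a I))" using I(1) by simp
  have "real (card {S \<in> symm_on (insert a I). ?P S}) =
      (\<Sum>S\<in>symm_on (insert a I). ?G (\<lambda>w v. of_bool (w = 2 ^ k \<and> v)) S)"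
    by (rule real_card_Collect[OF fin])
  also have "\<dots> = (\<Sum>S\<in>symm_on I. 2 * (M - M / 2 ^ Suc k) * of_bool (card (kern I S) = 2 ^ Suc k)
      + M / 2 ^ k * of_bool (card (kern I S) = 2 ^ k))"
    unfolding sum[where F = "\<lambda>w v. of_bool (w = 2 ^ k \<and> v)"]
  proof (intro sum.cong refl)
    fix S :: "'a \<Rightarrow> 'a \<Rightarrow> bit"
    \<comment> \<open>Writing the size as a power of two turns conditions on sizes into conditions
      on exponents. Size 1 halves to 0, which is no power of two, so no spurious term
      appears.\<close>
    obtain m where m: "card (kern I S) = 2 ^ m" by (rule card_kern_power[OF I(1)])
    have h1: "(2 ^ m :: nat) div 2 = 2 ^ k \<longleftrightarrow> m = Suc k" by (cases m) auto
    have h2: "(2::nat) * 2 ^ m = 2 ^ k \<longleftrightarrow> Suc m = k"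
      using power_inject_exp[of "2::nat" "Suc m" k] by simp
    have h3: "(2 ^ m :: nat) = 2 ^ j \<longleftrightarrow> m = j" for j by simp
    show "2 * (M - M / card (kern I S)) * of_bool (card (kern I S) div 2 = 2 ^ k \<and> True)
        + M / card (kern I S) * (of_bool (card (kern I S) = 2 ^ k \<and> True)
          + of_bool (2 * card (kern I S) = 2 ^ k \<and> False)) =
      2 * (M - M / 2 ^ Suc k) * of_bool (card (kern I S) = 2 ^ Suc k)
      + M / 2 ^ k * of_bool (card (kern I S) = 2 ^ k)"
      unfolding m h1 h2 h3 by auto
  qed
  also have "\<dots> = 2 * (M - M / 2 ^ Suc k) * (C * p (Suc k)) + M / 2 ^ k * (C * p k)"
    by (simp only: sum.distrib p flip: sum_distrib_left)
  finally show "symm_prob (insert a I) ?P =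
      symm_prob I (\<lambda>S. card (kern I S) = 2 ^ Suc k) * (1 - 1 / 2 ^ Suc k)
      + symm_prob I (\<lambda>S. card (kern I S) = 2 ^ k) / 2 ^ Suc k"
    unfolding symm_prob_def[of "insert a I"] C' p_def[symmetric]
    using M C by (simp add: field_simps)
  have "real (card {S \<in> symm_on (insert a I). ?N S}) =
      (\<Sum>S\<in>symm_on (insert a I). ?G (\<lambda>w v. of_bool (w = 2 ^ k \<and> \<not> v)) S)"
    by (rule real_card_Collect[OF fin])
  also have "\<dots> = (\<Sum>S\<in>symm_on I. (if k = 0 then 0 else M / 2 ^ (k - 1)) *
      of_bool (card (kern I S) = 2 ^ (k - 1)))"
    unfolding sum[where F = "\<lambda>w v. of_bool (w = 2 ^ k \<and> \<not> v)"]
  proof (intro sum.cong refl)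
    fix S :: "'a \<Rightarrow> 'a \<Rightarrow> bit"
    obtain m where m: "card (kern I S) = 2 ^ m" by (rule card_kern_power[OF I(1)])
    have h1: "(2 ^ m :: nat) div 2 = 2 ^ k \<longleftrightarrow> m = Suc k" by (cases m) auto
    have h2: "(2::nat) * 2 ^ m = 2 ^ k \<longleftrightarrow> Suc m = k"
      using power_inject_exp[of "2::nat" "Suc m" k] by simp
    have h3: "(2 ^ m :: nat) = 2 ^ j \<longleftrightarrow> m = j" for j by simp
    show "2 * (M - M / card (kern I S)) * of_bool (card (kern I S) div 2 = 2 ^ k \<and> \<not> True)
        + M / card (kern I S) * (of_bool (card (kern I S) = 2 ^ k \<and> \<not> True)
          + of_bool (2 * card (kern I S) = 2 ^ k \<and> \<not> False)) =
      (if k = 0 then 0 else M / 2 ^ (k - 1)) * of_bool (card (kern I S) = 2 ^ (k - 1))"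
      unfolding m h1 h2 h3 by (cases k) auto
  qed
  also have "\<dots> = (if k = 0 then 0 else M / 2 ^ (k - 1)) * (C * p (k - 1))"
    by (simp only: p flip: sum_distrib_left)
  finally show "symm_prob (insert a I) ?N =
      (if k = 0 then 0 else symm_prob I (\<lambda>S. card (kern I S) = 2 ^ (k - 1)) / 2 ^ k)"
    unfolding symm_prob_def[of "insert a I"] C' p_def[symmetric]
    using M C by (cases k) (simp_all add: field_simps)
qed

lemma symm_prob_disj:
  assumes "finite I"
  shows "symm_prob I P = symm_prob I (\<lambda>S. P S \<and> Q S) + symm_prob I (\<lambda>S. P S \<and> \<not> Q S)"
proof -
  have "card {S \<in> symm_on I. P S} =
      card {S \<in> symm_on I. P S \<and> Q S} + card {S \<in> symm_on I. P S \<and> \<not> Q S}"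
    by (subst card_Un_disjoint[symmetric]) (use assms in \<open>auto intro: arg_cong[where f = card]\<close>)
  then show ?thesis by (simp add: symm_prob_def add_divide_distrib)
qed

text \<open>Adding the two halves of \<open>symm_prob_insert\<close> forgets the vanishing bit and
  leaves the recursion \<open>corank_prob_Suc\<close>.\<close>

lemma symm_prob_kern:
  fixes I :: "'a set"
  assumes "finite I"
  shows "symm_prob I (\<lambda>S. card (kern I S) = 2 ^ k) = corank_prob (card I) k"
  using assms
proof (induction I arbitrary: k)
  case empty
  have "kern {} S = {\<lambda>_. 0}" for S :: "'a \<Rightarrow> 'a \<Rightarrow> bit"
    by (auto simp: kern_def vec_on_def mat_vec_def)
  then have "card (kern {} S) = 1" for S :: "'a \<Rightarrow> 'a \<Rightarrow> bit" by simp
  then have "{S \<in> symm_on {}. card (kern {} S) = 2 ^ k} = (if k = 0 then symm_on {} else ({} :: ('a \<Rightarrow> 'a \<Rightarrow> bit) set))"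
    using power_inject_exp[of "2::nat" 0 k] by (auto simp del: power_inject_exp)
  then show ?case by (simp add: symm_prob_def corank_prob_0 symm_on_empty)
next
  case (insert a I)
  have "symm_prob (insert a I) (\<lambda>S. card (kern (insert a I) S) = 2 ^ k) =
      symm_prob (insert a I) (\<lambda>S. card (kern (insert a I) S) = 2 ^ k \<and> vanish_at a (insert a I) S) +
      symm_prob (insert a I) (\<lambda>S. card (kern (insert a I) S) = 2 ^ k \<and> \<not> vanish_at a (insert a I) S)"
    using insert.hyps by (intro symm_prob_disj) simp
  also have "\<dots> = corank_prob (Suc (card I)) k"
    unfolding symm_prob_insert[OF insert.hyps] insert.IH corank_prob_Suc by simp
  finally show ?case using insert.hyps by simp
qed

lemma pmf_map_pmf_of_symm:
  assumes "finite I"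
  shows "pmf (map_pmf f (pmf_of_set (symm_on I))) y = symm_prob I (\<lambda>S. f S = y)"
  using assms by (simp add: pmf_map measure_pmf_of_set symm_prob_def vimage_def Int_def)

section \<open>Laws of the kernel size and of the vanishing bit, and their limits\<close>

definition kern_law :: "'a set \<Rightarrow> nat pmf" where
  "kern_law I = map_pmf (\<lambda>S. card (kern I S)) (pmf_of_set (symm_on I))"

definition kern_vanish_law :: "'a \<Rightarrow> 'a set \<Rightarrow> (nat \<times> bool) pmf" where
  "kern_vanish_law a I = map_pmf (\<lambda>S. (card (kern I S), vanish_at a I S)) (pmf_of_set (symm_on I))"

lemma pmf_kern_law: "finite I \<Longrightarrow> pmf (kern_law I) (2 ^ k) = corank_prob (card I) k"
  by (simp add: kern_law_def pmf_map_pmf_of_symm symm_prob_kern)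

lemma pmf_kern_vanish_law:
  assumes "finite I" "a \<notin> I"
  shows "pmf (kern_vanish_law a (insert a I)) (2 ^ k, True) =
      corank_prob (card I) (Suc k) * (1 - 1 / 2 ^ Suc k) + corank_prob (card I) k / 2 ^ Suc k"
    and "pmf (kern_vanish_law a (insert a I)) (2 ^ k, False) =
      (if k = 0 then 0 else corank_prob (card I) (k - 1) / 2 ^ k)"
  using symm_prob_insert[OF assms, of k] assms(1)
  by (simp_all add: kern_vanish_law_def pmf_map_pmf_of_symm symm_prob_kern del: power_Suc)

lemma sums_wt: "(\<lambda>k. limc * wt k) sums 1"
  using sums_mult[OF summable_sums[OF summable_wt_power[of 1]], of limc] wt_series_1
  by (simp add: wt_series_def)

lemma sums_wt_half: "(\<lambda>k. limc * wt k / 2 ^ k) sums (2 / 3)"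
proof -
  have "(\<lambda>k. limc * (wt k * (1 / 2) ^ k)) sums (limc * wt_series (1 / 2))"
    unfolding wt_series_def by (intro sums_mult summable_sums summable_wt_power) auto
  then show ?thesis unfolding wt_series_half by (simp add: power_divide)
qed

definition limit_corank :: "nat pmf" where
  "limit_corank = embed_pmf (\<lambda>k. limc * wt k)"

lemma pmf_limit_corank: "pmf limit_corank k = limc * wt k"
  unfolding limit_corank_def
proof (rule pmf_embed_pmf)
  show nn: "0 \<le> limc * wt k" for k using limc_pos wt_pos[of k] by simp
  show "(\<integral>\<^sup>+ k. ennreal (limc * wt k) \<partial>count_space UNIV) = 1"
    using suminf_ennreal_eq[OF nn sums_wt] by (simp add: nn_integral_count_space_nat)
qed

text \<open>Given corank k the bit is true with probability 2^-k, the chance that a fixed coordinate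
  is 0 in k independent uniform vectors. The first component stores the kernel size rather than the
  corank.\<close>

definition limit_joint :: "(nat \<times> bool) pmf" where
  "limit_joint = bind_pmf limit_corank (\<lambda>k. map_pmf (Pair (2 ^ k)) (bernoulli_pmf (1 / 2 ^ k)))"

lemma pmf_limit_joint:
  "pmf limit_joint (2 ^ k, b) = limc * wt k * (if b then 1 / 2 ^ k else 1 - 1 / 2 ^ k)"
proof -
  let ?c = "if b then 1 / 2 ^ k else 1 - 1 / 2 ^ k :: real"
  have "pmf (map_pmf (Pair (2 ^ j :: nat)) (bernoulli_pmf (1 / 2 ^ j))) (2 ^ k, b) =
      indicator {k} j * ?c" for j
  proof (cases "j = k")
    case True
    have "inj (Pair (2 ^ k :: nat) :: bool \<Rightarrow> _)" by (simp add: inj_on_def)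
    from pmf_map_inj'[OF this] True show ?thesis by simp
  next
    case False
    then show ?thesis by (subst pmf_map_outside) auto
  qed
  then have "pmf limit_joint (2 ^ k, b) = (\<integral>j. indicator {k} j * ?c \<partial>measure_pmf limit_corank)"
    unfolding limit_joint_def pmf_bind by presburger
  also have "\<dots> = limc * wt k * ?c"
    by (simp add: measure_pmf_single pmf_limit_corank)
  finally show ?thesis .
qed

lemma set_limit_joint: "set_pmf limit_joint \<subseteq> {(2 ^ k, b) | k b. True}"
  by (auto simp: limit_joint_def)

lemma kern_law_LIMSEQ:
  assumes "\<And>n. finite (I n)" "filterlim (\<lambda>n. card (I n)) at_top sequentially"
    and "x \<in> set_pmf (map_pmf (\<lambda>k. 2 ^ k) limit_corank)"
  shows "(\<lambda>n. pmf (kern_law (I n)) x) \<longlonglongrightarrow> pmf (map_pmf (\<lambda>k. 2 ^ k) limit_corank) x"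
proof -
  obtain k where k: "x = 2 ^ k" using assms(3) by auto
  have "inj (\<lambda>k. 2 ^ k :: nat)" by (simp add: inj_on_def)
  from pmf_map_inj'[OF this]
  have "pmf (map_pmf (\<lambda>k. 2 ^ k) limit_corank) x = limc * wt k" by (simp add: k pmf_limit_corank)
  moreover have "(\<lambda>n. corank_prob (card (I n)) k) \<longlonglongrightarrow> limc * wt k"
    by (rule filterlim_compose[OF corank_prob_LIMSEQ assms(2)])
  ultimately show ?thesis by (simp add: k pmf_kern_law assms(1))
qed

lemma kern_vanish_law_LIMSEQ:
  assumes "\<And>n. finite (I n)" "\<And>n. a n \<notin> I n" "filterlim (\<lambda>n. card (I n)) at_top sequentially"
    and "x \<in> set_pmf limit_joint"
  shows "(\<lambda>n. pmf (kern_vanish_law (a n) (insert (a n) (I n))) x) \<longlonglongrightarrow> pmf limit_joint x"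
proof -
  obtain k b where x: "x = (2 ^ k, b)" using assms(4) set_limit_joint by auto
  have lim: "(\<lambda>n. corank_prob (card (I n)) j) \<longlonglongrightarrow> limc * wt j" for j
    by (rule filterlim_compose[OF corank_prob_LIMSEQ assms(3)])
  show ?thesis
  proof (cases b)
    case True
    with x have x: "x = (2 ^ k, True)" by simp
    have "(\<lambda>n. corank_prob (card (I n)) (Suc k) * (1 - 1 / 2 ^ Suc k) + corank_prob (card (I n)) k / 2 ^ Suc k)
        \<longlonglongrightarrow> limc * wt (Suc k) * (1 - 1 / 2 ^ Suc k) + limc * wt k / 2 ^ Suc k"
      by (intro tendsto_intros lim) simp
    \<comment> \<open>By detailed balance, stepping down from k + 1 contributes as much as staying
      at k, and each is half of the target.\<close>
    moreover have "limc * wt (Suc k) * (1 - 1 / 2 ^ Suc k) + limc * wt k / 2 ^ Suc k = limc * wt k * (1 / 2 ^ k)"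
      unfolding mult.assoc wt_Suc_mult by simp
    ultimately show ?thesis
      unfolding x pmf_kern_vanish_law[OF assms(1,2)] pmf_limit_joint by simp
  next
    case False
    show ?thesis
    proof (cases k)
      \<comment> \<open>A trivial kernel vanishes at every coordinate, so both probabilities are
        0.\<close>
      case 0
      then have x: "x = (2 ^ 0, False)" using False x by simp
      show ?thesis unfolding x pmf_kern_vanish_law(2)[OF assms(1,2)] pmf_limit_joint by simp
    next
      case (Suc j)
      have "(\<lambda>n. corank_prob (card (I n)) j / 2 ^ k) \<longlonglongrightarrow> limc * wt j / 2 ^ k"
        by (intro tendsto_intros lim) simp
      moreover have "limc * wt j / 2 ^ k = limc * wt k * (1 - 1 / 2 ^ k)"
        unfolding mult.assoc Suc wt_Suc_mult by simp
      moreover have "pmf (kern_vanish_law (a n) (insert (a n) (I n))) x = corank_prob (card (I n)) j / 2 ^ k" for n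
        using False unfolding x by (simp add: pmf_kern_vanish_law(2)[OF assms(1,2)] Suc del: power_Suc)
      ultimately show ?thesis using False by (simp add: x pmf_limit_joint)
    qed
  qed
qed

section \<open>From pointwise limits of probabilities to convergence in distribution\<close>

lemma ex_finite_measure_pmf:
  assumes "e > 0"
  obtains F where "finite F" "F \<subseteq> set_pmf Q" "measure Q F > 1 - e"
proof -
  define A where "A n = from_nat_into (set_pmf Q) ` {..n}" for n
  have "(\<Union>n. A n) = from_nat_into (set_pmf Q) ` UNIV" by (auto simp: A_def)
  then have U: "(\<Union>n. A n) = set_pmf Q"
    by (simp add: range_from_nat_into set_pmf_not_empty)
  have "incseq A" by (auto simp: A_def incseq_def)
  then have "(\<lambda>n. measure Q (A n)) \<longlonglongrightarrow> measure Q (set_pmf Q)"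
    using measure_pmf.finite_Lim_measure_incseq[of A Q] U by auto
  also have "measure Q (set_pmf Q) = 1" by (simp add: measure_pmf.prob_eq_1 AE_measure_pmf)
  finally have "eventually (\<lambda>n. measure Q (A n) > 1 - e) sequentially"
    by (rule order_tendstoD) (use assms in simp)
  then obtain n where "measure Q (A n) > 1 - e" by (auto simp: eventually_sequentially)
  with that[of "A n"] U show ?thesis by (auto simp: A_def)
qed

text \<open>A version of Scheffe's lemma: no mass can escape because the limit is a probability.\<close>

lemma tendsto_measure_pmf:
  assumes "\<And>x. x \<in> set_pmf Q \<Longrightarrow> (\<lambda>n. pmf (P n) x) \<longlonglongrightarrow> pmf Q x"
  shows "(\<lambda>n. measure (measure_pmf (P n)) A) \<longlonglongrightarrow> measure (measure_pmf Q) A"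
proof -
  \<comment> \<open>A lower bound suffices: applied to the complement of \<open>A\<close> it becomes
    the upper bound. The finite set F carries almost all of the limiting mass, and on it convergence
    is that of a finite sum.\<close>
  have lower: "eventually (\<lambda>n. measure (P n) B > measure Q B - e) sequentially" if "e > 0" for B e
  proof -
    from \<open>e > 0\<close> obtain F where F: "finite F" "F \<subseteq> set_pmf Q" "measure Q F > 1 - e"
      by (rule ex_finite_measure_pmf)
    have "B \<subseteq> (B \<inter> F) \<union> - F" by auto
    then have "measure Q B \<le> measure Q (B \<inter> F) + measure Q (- F)"
      using measure_pmf.finite_measure_mono[of B "(B \<inter> F) \<union> - F" Q]
        measure_Un_le[of "B \<inter> F" Q "- F"] by auto
    also have "measure Q (- F) = 1 - measure Q F"
      using measure_pmf.prob_compl[of F Q] by (simp add: Compl_eq_Diff_UNIV)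
    finally have *: "measure Q B - e < measure Q (B \<inter> F)" using F(3) by simp
    have "(\<lambda>n. measure (P n) (B \<inter> F)) \<longlonglongrightarrow> measure Q (B \<inter> F)"
      unfolding measure_measure_pmf_finite[OF finite_Int[OF disjI2[OF F(1)]]]
      using assms F(2) by (intro tendsto_sum) auto
    from order_tendstoD(1)[OF this *] show ?thesis
      by eventually_elim (rule less_le_trans, assumption, rule measure_pmf.finite_measure_mono, auto)
  qed
  have compl: "measure (measure_pmf p) (- A) = 1 - measure (measure_pmf p) A" for p :: "'a pmf"
    using measure_pmf.prob_compl[of A p] by (simp add: Compl_eq_Diff_UNIV)
  show ?thesis
  proof (rule order_tendstoI)
    fix a assume "a < measure (measure_pmf Q) A"
    then show "eventually (\<lambda>n. a < measure (P n) A) sequentially"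
      using lower[of "measure Q A - a" A] by simp
  next
    fix a assume "measure (measure_pmf Q) A < a"
    then show "eventually (\<lambda>n. measure (P n) A < a) sequentially"
      using lower[of "a - measure Q A" "- A"] by (simp add: compl)
  qed
qed

text \<open>The probabilities of all sets converge, so the distribution functions converge at every
  point, jumps included. Equality of laws is asked only eventually because the exact formulas start
  at some small n.\<close>

lemma weak_conv_law:
  assumes "eventually (\<lambda>n. map_pmf (f n) (p n) = map_pmf g (P n)) sequentially"
    and "\<And>x. x \<in> set_pmf Q \<Longrightarrow> (\<lambda>n. pmf (P n) x) \<longlonglongrightarrow> pmf Q x"
  shows "weak_conv_m (\<lambda>n. law (p n) (f n)) (law (map_pmf g Q) (\<lambda>x. x))"
  unfolding weak_conv_m_def weak_conv_def
proof (intro allI impI)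
  fix x :: real
  have cdf: "cdf (law q h) x = measure (map_pmf h q) {..x}" for q :: "'z pmf" and h
    unfolding cdf_def law_def by (simp add: measure_distr)
  have "(\<lambda>n. measure (P n) (g -` {..x})) \<longlonglongrightarrow> measure Q (g -` {..x})"
    by (rule tendsto_measure_pmf[OF assms(2)])
  moreover have "eventually (\<lambda>n. measure (P n) (g -` {..x}) = cdf (law (p n) (f n)) x) sequentially"
    using assms(1) by eventually_elim (simp add: cdf)
  moreover have "cdf (law (map_pmf g Q) (\<lambda>x. x)) x = measure Q (g -` {..x})"
    unfolding cdf_def law_def by (simp add: measure_distr)
  ultimately show "(\<lambda>n. cdf (law (p n) (f n)) x) \<longlonglongrightarrow> cdf (law (map_pmf g Q) (\<lambda>x. x)) x"
    using Lim_transform_eventually by fastforce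
qed

text \<open>The detour through the natural numbers matches the shape
  \<open>map_pmf real (kern_law I)\<close> of the finite laws, as \<open>weak_conv_law\<close>
  requires.\<close>

definition limit_X :: "real pmf" where
  "limit_X = map_pmf real (map_pmf (\<lambda>k. 2 ^ k) limit_corank)"

definition limit_Z :: "real pmf" where
  "limit_Z = map_pmf (\<lambda>(w, v). if v then real w else 0) limit_joint"

lemma pmf_limit_X: "pmf limit_X (2 ^ k) = limc * wt k"
proof -
  have "limit_X = map_pmf (\<lambda>k. 2 ^ k) limit_corank" by (simp add: limit_X_def pmf.map_comp o_def)
  moreover have "inj (\<lambda>k::nat. 2 ^ k :: real)" by (simp add: inj_on_def)
  ultimately show ?thesis using pmf_map_inj' pmf_limit_corank by metis
qed

lemma pmf_limit_X_outside: "\<nexists>k::nat. x = 2 ^ k \<Longrightarrow> pmf limit_X x = 0"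
  unfolding limit_X_def by (rule pmf_map_outside) auto

lemma pmf_limit_Z: "pmf limit_Z (2 ^ k) = limc * wt k / 2 ^ k"
proof -
  have "pmf limit_Z (2 ^ k) = measure limit_joint {(2 ^ k, True)}"
    unfolding limit_Z_def pmf_map by (rule arg_cong[where f = "measure _"]) (auto split: if_splits)
  then show ?thesis by (simp add: measure_pmf_single pmf_limit_joint)
qed

lemma pmf_limit_Z_0: "pmf limit_Z 0 = 1 / 3"
proof -
  let ?T = "range (\<lambda>k. (2 ^ k :: nat, True))"
  have "inj (\<lambda>k. (2 ^ k :: nat, True))" by (simp add: inj_on_def)
  from nn_integral_pmf'[OF this, of limit_joint]
  have "emeasure limit_joint ?T = (\<Sum>k. ennreal (limc * wt k / 2 ^ k))"
    by (simp add: nn_integral_count_space_nat pmf_limit_joint)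
  also have "\<dots> = ennreal (2 / 3)"
    using limc_pos wt_pos by (intro suminf_ennreal_eq sums_wt_half) (simp add: less_imp_le)
  finally have T: "measure limit_joint ?T = 2 / 3"
    by (simp add: measure_def)
  \<comment> \<open>The first component is a power of two and never 0, so the value 0 occurs exactly
    when the bit is false.\<close>
  have "(case z of (w, v) \<Rightarrow> if v then real w else 0) = 0 \<longleftrightarrow> z \<in> - ?T" if "z \<in> set_pmf limit_joint" for z
  proof -
    from that set_limit_joint obtain k b where "z = (2 ^ k, b)" by auto
    then show ?thesis by auto
  qed
  then have "pmf limit_Z 0 = measure limit_joint (- ?T)"
    unfolding limit_Z_def pmf_map
    by (intro measure_pmf.finite_measure_eq_AE) (simp_all add: AE_measure_pmf_iff)
  also have "\<dots> = 1 / 3"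
    using measure_pmf.prob_compl[of ?T limit_joint] T by (simp add: Compl_eq_Diff_UNIV)
  finally show ?thesis .
qed

lemma pmf_limit_Z_outside: "x \<noteq> 0 \<Longrightarrow> \<nexists>k::nat. x = 2 ^ k \<Longrightarrow> pmf limit_Z x = 0"
  unfolding limit_Z_def using set_limit_joint by (intro pmf_map_outside) (auto split: if_splits)

section \<open>Change of basis\<close>

definition restr :: "'a set \<Rightarrow> ('a \<Rightarrow> 'a \<Rightarrow> bit) \<Rightarrow> 'a \<Rightarrow> 'a \<Rightarrow> bit" where
  "restr I S i j = (if i \<in> I \<and> j \<in> I then S i j else 0)"

lemma restr_in_symm_on: "(\<And>i j. S i j = S j i) \<Longrightarrow> restr I S \<in> symm_on I"
  by (auto simp: restr_def symm_on_def)

lemma mat_vec_restr: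
  "mat_vec I (restr I S) x i = (if i \<in> I then mat_vec I S x i else 0)"
  by (auto simp: mat_vec_def restr_def intro: sum.cong)

text \<open>Under the bordering bijection the block on \<open>K\<close> is one factor of a product
  set, so a principal submatrix of a uniform symmetric matrix is again uniform.\<close>

lemma map_restr_pmf_of_symm:
  assumes "finite K" "m \<notin> K"
  shows "map_pmf (restr K) (pmf_of_set (symm_on (insert m K))) = pmf_of_set (symm_on K)"
proof -
  let ?A = "symm_on K" and ?B = "vec_on K \<times> (UNIV :: bit set)"
  have ne: "?A \<noteq> {}" "?B \<noteq> {}" by (auto simp: vec_on_def)
  have fin: "finite ?A" "finite ?B" using assms(1) by auto
  have "pmf_of_set (symm_on (insert m K)) = map_pmf (\<lambda>(S, b, d). border m S b d) (pmf_of_set (?A \<times> ?B))"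
    using bij_betw_border[OF assms(2)] ne fin by (intro map_pmf_of_set_bij_betw[symmetric]) auto
  then have "map_pmf (restr K) (pmf_of_set (symm_on (insert m K))) =
      map_pmf (\<lambda>(S, b, d). restr K (border m S b d)) (pmf_of_set (?A \<times> ?B))"
    by (simp add: pmf.map_comp o_def split_def)
  also have "\<dots> = map_pmf fst (pmf_of_set (?A \<times> ?B))"
  proof (rule map_pmf_cong[OF refl])
    fix q assume "q \<in> set_pmf (pmf_of_set (?A \<times> ?B))"
    then have "q \<in> ?A \<times> ?B" using ne fin by (subst (asm) set_pmf_of_set) auto
    moreover have "restr K (border m S b d) = S" if "S \<in> ?A" for S b d
      using assms(2) symm_on_outside[OF that] by (auto simp: restr_def border_def fun_eq_iff)
    ultimately show "(case q of (S, b, d) \<Rightarrow> restr K (border m S b d)) = fst q" by auto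
  qed
  also have "pmf_of_set (?A \<times> ?B) = pair_pmf (pmf_of_set ?A) (pmf_of_set ?B)"
  proof (rule pmf_eqI)
    fix q
    have "pmf (pmf_of_set (?A \<times> ?B)) q = indicator (?A \<times> ?B) q / card (?A \<times> ?B)"
      using ne fin by (intro pmf_of_set) auto
    also have "\<dots> = indicator ?A (fst q) / card ?A * (indicator ?B (snd q) / card ?B)"
      by (cases q) (simp add: indicator_def card_cartesian_product)
    also have "\<dots> = pmf (pmf_of_set ?A) (fst q) * pmf (pmf_of_set ?B) (snd q)"
      unfolding pmf_of_set[OF ne(1) fin(1)] pmf_of_set[OF ne(2) fin(2)] ..
    also have "\<dots> = pmf (pair_pmf (pmf_of_set ?A) (pmf_of_set ?B)) q"
      by (metis pmf_pair prod.collapse)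
    finally show "pmf (pmf_of_set (?A \<times> ?B)) q = pmf (pair_pmf (pmf_of_set ?A) (pmf_of_set ?B)) q" .
  qed
  finally show ?thesis by (simp add: map_fst_pair_pmf)
qed

lemma map_add_pmf_of_symm:
  assumes "finite I" "C \<in> symm_on I"
  shows "map_pmf (\<lambda>S i j. S i j + C i j) (pmf_of_set (symm_on I)) = pmf_of_set (symm_on I)"
proof (rule map_pmf_of_set_bij_betw)
  show "bij_betw (\<lambda>S i j. S i j + C i j) (symm_on I) (symm_on I)"
    by (rule bij_betw_byWitness[where f' = "\<lambda>S i j. S i j + C i j"])
       (use assms(2) in \<open>auto simp: symm_on_def add.assoc\<close>)
qed (use assms in auto)

text \<open>\<open>shear_mat K m S\<close> is the Gram matrix of \<open>S\<close> in the basis \<open>e\<^sub>m\<close>, \<open>e\<^sub>j + e\<^sub>m\<close> (\<open>j \<in> K\<close>);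
  the dual change of basis maps the all-ones vector to \<open>e\<^sub>m\<close>.\<close>

definition shear_mat :: "'a set \<Rightarrow> 'a \<Rightarrow> ('a \<Rightarrow> 'a \<Rightarrow> bit) \<Rightarrow> 'a \<Rightarrow> 'a \<Rightarrow> bit" where
  "shear_mat K m S i j = S i j + of_bool (j \<in> K) * S i m + of_bool (i \<in> K) * S m j
     + of_bool (i \<in> K) * of_bool (j \<in> K) * S m m"

lemma shear_mat_symm_on: "m \<notin> K \<Longrightarrow> S \<in> symm_on (insert m K) \<Longrightarrow> shear_mat K m S \<in> symm_on (insert m K)"
  by (auto simp: symm_on_def shear_mat_def ac_simps)

lemma shear_mat_shear_mat:
  assumes "m \<notin> K"
  shows "shear_mat K m (shear_mat K m S) = S"
proof (intro ext)
  fix i j show "shear_mat K m (shear_mat K m S) i j = S i j"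
    using assms by (cases "i \<in> K"; cases "j \<in> K") (auto simp: shear_mat_def ac_simps)
qed

lemma map_shear_mat_pmf_of_symm:
  assumes "finite K" "m \<notin> K"
  shows "map_pmf (shear_mat K m) (pmf_of_set (symm_on (insert m K))) = pmf_of_set (symm_on (insert m K))"
proof (rule map_pmf_of_set_bij_betw)
  show "bij_betw (shear_mat K m) (symm_on (insert m K)) (symm_on (insert m K))"
    by (rule bij_betw_byWitness[where f' = "shear_mat K m"]) (auto simp: shear_mat_shear_mat shear_mat_symm_on assms(2))
qed (use assms in auto)

text \<open>The basis change P acting on coordinates, its own inverse in characteristic 2 when m is
  not in \<open>K\<close>; over \<open>insert m K\<close>, the matrix \<open>shear_mat K m S\<close>
  is then P^T S P.\<close>

definition shear :: "'a set \<Rightarrow> 'a \<Rightarrow> ('a \<Rightarrow> bit) \<Rightarrow> 'a \<Rightarrow> bit" where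
  "shear K m x = x(m := x m + sum x K)"

lemma sum_shear: "m \<notin> K \<Longrightarrow> (\<Sum>j\<in>K. c j * shear K m x j) = (\<Sum>j\<in>K. c j * x j)"
  by (intro sum.cong) (auto simp: shear_def)

lemma shear_shear: "m \<notin> K \<Longrightarrow> shear K m (shear K m x) = x"
proof -
  assume "m \<notin> K"
  then have "sum (shear K m x) K = sum x K" using sum_shear[of m K "\<lambda>_. 1"] by simp
  then show ?thesis by (simp add: shear_def add.assoc)
qed

lemma mat_vec_shear_mat:
  assumes "finite K" "m \<notin> K"
  shows "mat_vec (insert m K) (shear_mat K m S) x i =
    mat_vec (insert m K) S (shear K m x) i + of_bool (i \<in> K) * mat_vec (insert m K) S (shear K m x) m"
proof -
  have *: "mat_vec (insert m K) S (shear K m x) i = S i m * (x m + sum x K) + (\<Sum>j\<in>K. S i j * x j)" for i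
    using assms by (simp add: mat_vec_def sum_shear) (simp add: shear_def)
  have "mat_vec (insert m K) (shear_mat K m S) x i = (S i m + of_bool (i \<in> K) * S m m) * x m +
      (\<Sum>j\<in>K. (S i j + S i m + of_bool (i \<in> K) * (S m j + S m m)) * x j)"
  proof -
    have "(\<Sum>j\<in>K. shear_mat K m S i j * x j) = (\<Sum>j\<in>K. (S i j + S i m + of_bool (i \<in> K) * (S m j + S m m)) * x j)"
      by (intro sum.cong refl, cases "i \<in> K") (simp_all add: shear_mat_def add.assoc)
    then show ?thesis using assms by (simp add: mat_vec_def) (simp add: shear_mat_def)
  qed
  also have "(\<Sum>j\<in>K. (S i j + S i m + of_bool (i \<in> K) * (S m j + S m m)) * x j) =
      (\<Sum>j\<in>K. S i j * x j) + S i m * sum x K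
      + of_bool (i \<in> K) * ((\<Sum>j\<in>K. S m j * x j) + S m m * sum x K)"
  proof -
    have "(\<Sum>j\<in>K. (S i j + S i m + of_bool (i \<in> K) * (S m j + S m m)) * x j) =
        (\<Sum>j\<in>K. S i j * x j + S i m * x j + of_bool (i \<in> K) * (S m j * x j + S m m * x j))"
      by (intro sum.cong refl) (simp only: algebra_simps)
    then show ?thesis by (simp only: sum.distrib sum_distrib_left[symmetric])
  qed
  finally show ?thesis unfolding * by (simp only: algebra_simps)
qed

text \<open>The purpose of the basis change: orthogonality of the all-ones vector to the kernel
  becomes vanishing of a single coordinate, the event that the bordering recursion follows.\<close>

lemma kern_shear_mat:
  assumes K: "finite K" "m \<notin> K"
  shows "card (kern (insert m K) (shear_mat K m S)) = card (kern (insert m K) S)"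
    and "vanish_at m (insert m K) (shear_mat K m S) \<longleftrightarrow> (\<forall>y\<in>kern (insert m K) S. sum y (insert m K) = 0)"
proof -
  let ?I = "insert m K"
  have vec: "shear K m x \<in> vec_on ?I" if "x \<in> vec_on ?I" for x
    using that by (auto simp: vec_on_def shear_def)
  have iff: "x \<in> kern ?I (shear_mat K m S) \<longleftrightarrow> shear K m x \<in> kern ?I S" for x
  proof -
    have "x \<in> vec_on ?I \<longleftrightarrow> shear K m x \<in> vec_on ?I" using vec[of x] vec[of "shear K m x"] shear_shear[OF K(2)] by auto
    moreover have "(\<forall>i. mat_vec ?I (shear_mat K m S) x i = 0) \<longleftrightarrow> (\<forall>i. mat_vec ?I S (shear K m x) i = 0)"
    proof (intro iffI allI)
      fix i assume 0: "\<forall>i. mat_vec ?I (shear_mat K m S) x i = 0"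
      have "mat_vec ?I S (shear K m x) m = 0"
        using 0[rule_format, of m] K(2) by (simp add: mat_vec_shear_mat[OF K])
      then show "mat_vec ?I S (shear K m x) i = 0"
        using 0[rule_format, of i] by (simp add: mat_vec_shear_mat[OF K])
    qed (simp add: mat_vec_shear_mat[OF K])
    ultimately show ?thesis by (simp add: kern_def)
  qed
  have bij: "bij_betw (shear K m) (kern ?I (shear_mat K m S)) (kern ?I S)"
    by (rule bij_betw_byWitness[where f' = "shear K m"])
      (simp_all only: image_subset_iff Ball_def iff shear_shear[OF K(2)] simp_thms)
  then show "card (kern ?I (shear_mat K m S)) = card (kern ?I S)" by (rule bij_betw_same_card)
  have sum: "sum (shear K m x) ?I = x m" for x
  proof -
    have "sum (shear K m x) ?I = shear K m x m + sum (shear K m x) K"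
      using K by (rule sum.insert)
    also have "shear K m x m = x m + sum x K" by (simp add: shear_def)
    also have "sum (shear K m x) K = sum x K" using sum_shear[of m K "\<lambda>_. 1"] K by simp
    finally show ?thesis by (simp add: add.assoc)
  qed
  have "(\<forall>y\<in>kern ?I S. sum y ?I = 0) \<longleftrightarrow> (\<forall>y\<in>shear K m ` kern ?I (shear_mat K m S). sum y ?I = 0)"
    using bij_betw_imp_surj_on[OF bij] by simp
  then show "vanish_at m ?I (shear_mat K m S) \<longleftrightarrow> (\<forall>y\<in>kern ?I S. sum y ?I = 0)"
    by (simp add: vanish_at_def sum)
qed

section \<open>Kernels of symmetric matrices whose rows sum to one\<close>

lemma of_nat_bit: "(of_nat k :: bit) = of_bool (odd k)"
  by (induction k) auto

lemma sum_mat_vec: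
  assumes "T \<in> symm_on V"
  shows "(\<Sum>i\<in>V. mat_vec V T x i) = (\<Sum>j\<in>V. (\<Sum>i\<in>V. T j i) * x j)"
proof -
  have "(\<Sum>i\<in>V. mat_vec V T x i) = (\<Sum>j\<in>V. \<Sum>i\<in>V. T i j * x j)"
    unfolding mat_vec_def by (rule sum.swap)
  also have "\<dots> = (\<Sum>j\<in>V. (\<Sum>i\<in>V. T j i) * x j)"
    unfolding sum_distrib_right using symm_on_commute[OF assms] by (intro sum.cong refl) simp
  finally show ?thesis .
qed

text \<open>Since \<open>T 1 = 1\<close>, in odd dimension \<open>T\<close> is the orthogonal sum of its restrictions to the line
  spanned by \<open>1\<close> and to \<open>1\<^sup>\<bottom>\<close>.\<close>

lemma card_kern_row_sum_odd:
  assumes I: "finite I" "a \<notin> I" "even (card I)" and T: "T \<in> symm_on (insert a I)"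
    and row: "\<And>i. i \<in> insert a I \<Longrightarrow> (\<Sum>j\<in>insert a I. T i j) = 1"
  shows "card (kern (insert a I) T) = card (kern I (restr I (\<lambda>i j. T i j + 1)))"
proof (rule bij_betw_same_card)
  let ?V = "insert a I" and ?R = "restr I (\<lambda>i j. T i j + 1)"
  \<comment> \<open>In odd dimension the vectors e_i + 1 with i in \<open>I\<close> form a basis of
    the orthogonal complement of 1, and as T 1 = 1 their Gram matrix has entries
    \<open>T i j + 1\<close>, which is \<open>?R\<close>. The map \<open>?G\<close> expands a vector
    in this basis, and \<open>?F\<close> reads off its coordinates.\<close>
  let ?F = "\<lambda>x i. if i \<in> I then x i + x a else 0 :: bit"
  let ?G = "\<lambda>y i. if i \<in> ?V then y i + sum y I else 0 :: bit"
  have row': "(\<Sum>j\<in>I. T i j) = 1 + T i a" if "i \<in> ?V" for i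
  proof -
    have "T i a + (\<Sum>j\<in>I. T i j) = 1" using row[OF that] I by simp
    then show ?thesis by (metis add.commute bit_add_self_left)
  qed
  have const: "(\<Sum>j\<in>I. t) = (0::bit)" for t using I(3) by (simp add: of_nat_bit)
  have colsum: "(\<Sum>i\<in>?V. mat_vec ?V T x i) = sum x ?V" for x
    unfolding sum_mat_vec[OF T] using row by (intro sum.cong) auto
  have out: "mat_vec ?V T x i = 0" if "i \<notin> ?V" for x i
    using symm_on_outside[OF T] that by (simp add: mat_vec_def)
  have ker: "sum x I = x a" "(\<Sum>j\<in>I. T i j * x j) = T i a * x a" if "x \<in> kern ?V T" for x i
  proof -
    have 0: "mat_vec ?V T x i = 0" for i using that by (simp add: kern_def)
    have "sum x ?V = 0" using colsum[of x] by (simp only: 0 sum.neutral_const)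
    then show "sum x I = x a" using I by (simp add: bit_add_eq_0_iff)
    show "(\<Sum>j\<in>I. T i j * x j) = T i a * x a"
      using 0[of i] I by (simp add: mat_vec_def bit_add_eq_0_iff)
  qed
  have F_sum: "(\<Sum>j\<in>I. c j * ?F x j) = (\<Sum>j\<in>I. c j * x j) + (\<Sum>j\<in>I. c j) * x a" for c x
  proof -
    have "(\<Sum>j\<in>I. c j * ?F x j) = (\<Sum>j\<in>I. c j * x j + c j * x a)"
      by (intro sum.cong refl) (simp add: distrib_left)
    then show ?thesis by (simp only: sum.distrib sum_distrib_right)
  qed
  show "bij_betw ?F (kern ?V T) (kern I ?R)"
  proof (rule bij_betw_byWitness[where f' = ?G])
    show "\<forall>x\<in>kern ?V T. ?G (?F x) = x"
    proof (intro ballI ext)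
      fix x i assume x: "x \<in> kern ?V T"
      have "sum (?F x) I = x a" using F_sum[of "\<lambda>_. 1" x] ker(1)[OF x] const by simp
      then show "?G (?F x) i = x i"
        using x I(2) by (auto simp: kern_def vec_on_def add.assoc)
    qed
    show "\<forall>y\<in>kern I ?R. ?F (?G y) = y"
    proof (intro ballI ext)
      fix y i assume y: "y \<in> kern I ?R"
      then have "y a = 0" using I(2) by (auto simp: kern_def vec_on_def)
      with y show "?F (?G y) i = y i" by (auto simp: kern_def vec_on_def add.assoc)
    qed
    show "?F ` kern ?V T \<subseteq> kern I ?R"
    proof (rule image_subsetI)
      fix x assume x: "x \<in> kern ?V T"
      have "mat_vec I ?R (?F x) i = 0" for i
      proof (cases "i \<in> I")
        case True
        have "mat_vec I ?R (?F x) i = (\<Sum>j\<in>I. (T i j + 1) * ?F x j)"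
          using True by (simp add: mat_vec_restr) (simp add: mat_vec_def)
        also have "\<dots> = (\<Sum>j\<in>I. T i j * x j) + sum x I + ((\<Sum>j\<in>I. T i j) + (\<Sum>j\<in>I. 1)) * x a"
          unfolding F_sum[of "\<lambda>j. T i j + 1" x] by (simp only: distrib_right sum.distrib mult_1_left)
        also have "\<dots> = 0"
          using True by (simp only: ker[OF x] row' const insert_iff simp_thms) (simp add: algebra_simps)
        finally show ?thesis .
      qed (simp add: mat_vec_restr)
      then show "?F x \<in> kern I ?R" by (simp add: kern_def vec_on_def)
    qed
    show "?G ` kern I ?R \<subseteq> kern ?V T"
    proof (rule image_subsetI)
      fix y assume y: "y \<in> kern I ?R"
      then have ya: "y a = 0" using I(2) by (auto simp: kern_def vec_on_def)
      have onI: "mat_vec ?V T (?G y) i = 0" if i: "i \<in> I" for i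
      proof -
        have "mat_vec ?V T (?G y) i = (\<Sum>j\<in>?V. T i j * y j) + (\<Sum>j\<in>?V. T i j) * sum y I"
          unfolding mat_vec_def by (simp only: sum_distrib_right sum.distrib[symmetric])
            (intro sum.cong refl, simp add: algebra_simps)
        also have "\<dots> = (\<Sum>j\<in>I. T i j * y j) + sum y I" using row i I ya by simp
        also have "\<dots> = mat_vec I ?R y i"
          using i by (simp add: mat_vec_restr) (simp add: mat_vec_def algebra_simps sum.distrib)
        also have "\<dots> = 0" using y by (simp add: kern_def)
        finally show ?thesis .
      qed
      \<comment> \<open>The equation at \<open>a\<close> comes for free: by \<open>colsum\<close>
        the entries of the image add up to the sum of \<open>?G y\<close>, which is 0, and all other
        entries vanish.\<close>
      have "sum (?G y) I = sum y I" using const by (simp add: sum.distrib)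
      then have "sum (?G y) ?V = 0" using I ya by simp
      then have "(\<Sum>i\<in>?V. mat_vec ?V T (?G y) i) = 0" by (simp only: colsum)
      moreover have "(\<Sum>i\<in>I. mat_vec ?V T (?G y) i) = 0" by (intro sum.neutral ballI onI)
      ultimately have "mat_vec ?V T (?G y) a = 0"
        by (simp only: sum.insert[OF I(1,2)] add_0_right)
      then have "mat_vec ?V T (?G y) i = 0" for i
        using onI out by (cases "i \<in> ?V") auto
      then show "?G y \<in> kern ?V T" by (auto simp: kern_def vec_on_def)
    qed
  qed
qed

text \<open>In even dimension \<open>1 \<in> 1\<^sup>\<bottom>\<close>, and \<open>T\<close> induces a form on the quotient of \<open>1\<^sup>\<bottom>\<close> by \<open>1\<close>.\<close>

lemma card_kern_row_sum_even:
  assumes K: "finite K" "m \<notin> K" "a \<notin> insert m K" "even (card K)"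
    and T: "T \<in> symm_on (insert a (insert m K))"
    and row: "\<And>i. i \<in> insert a (insert m K) \<Longrightarrow> (\<Sum>j\<in>insert a (insert m K). T i j) = 1"
  shows "card (kern (insert a (insert m K)) T) = card (kern K (restr K (shear_mat K m T)))"
proof (rule bij_betw_same_card)
  let ?I = "insert m K" and ?R = "restr K (shear_mat K m T)"
  let ?V = "insert a ?I"
  let ?F = "\<lambda>x i. if i \<in> K then x i + x a else 0 :: bit"
  \<comment> \<open>\<open>up z\<close> represents a class modulo 1 by its member that is 0 at
    \<open>a\<close>; the entry at m makes the total 0.\<close>
  define up where "up z = z(m := sum z K)" for z :: "'a \<Rightarrow> bit"
  \<comment> \<open>For z in the kernel of the induced form, \<open>T\<close> sends
    \<open>up z\<close> to a constant vector, whose value is read off at m. Since T 1 = 1, adding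
    that multiple of 1, as \<open>?G\<close> does, cancels it.\<close>
  define t where "t z = (\<Sum>j\<in>?I. T m j * up z j)" for z
  let ?G = "\<lambda>z i. if i \<in> ?V then up z i + t z else 0"
  have ne: "m \<noteq> a" using K by auto
  have row': "(\<Sum>j\<in>K. T i j) = 1 + T i a + T i m" if "i \<in> ?V" for i
  proof -
    have "T i a + (T i m + (\<Sum>j\<in>K. T i j)) = 1" using row[OF that] K by simp
    then show ?thesis by (metis add.assoc add.commute bit_add_self_left)
  qed
  have const: "(\<Sum>j\<in>K. t) = (0::bit)" for t using K(4) by (simp add: of_nat_bit)
  have colsum: "(\<Sum>i\<in>?V. mat_vec ?V T x i) = sum x ?V" for x
    unfolding sum_mat_vec[OF T] using row by (intro sum.cong) auto
  have out: "mat_vec ?V T x i = 0" if "i \<notin> ?V" for x i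
    using symm_on_outside[OF T] that by (simp add: mat_vec_def)
  have ker: "sum x K = x a + x m" "(\<Sum>j\<in>K. T i j * x j) = T i a * x a + T i m * x m"
    if "x \<in> kern ?V T" for x i
  proof -
    have 0: "mat_vec ?V T x i = 0" for i using that by (simp add: kern_def)
    have "sum x ?V = 0" using colsum[of x] by (simp only: 0 sum.neutral_const)
    then show "sum x K = x a + x m" using K by (simp add: bit_add_eq_0_iff flip: add.assoc)
    have "T i a * x a + (T i m * x m + (\<Sum>j\<in>K. T i j * x j)) = 0"
      using 0[of i] K by (simp add: mat_vec_def)
    then show "(\<Sum>j\<in>K. T i j * x j) = T i a * x a + T i m * x m"
      by (metis add.assoc bit_add_eq_0_iff)
  qed
  have F_sum: "(\<Sum>j\<in>K. c j * ?F x j) = (\<Sum>j\<in>K. c j * x j) + (\<Sum>j\<in>K. c j) * x a" for c x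
  proof -
    have "(\<Sum>j\<in>K. c j * ?F x j) = (\<Sum>j\<in>K. c j * x j + c j * x a)"
      by (intro sum.cong refl) (simp add: distrib_left)
    then show ?thesis by (simp only: sum.distrib sum_distrib_right)
  qed
  have F_row: "(\<Sum>j\<in>K. T i j * ?F x j) + T i m * sum (?F x) K = x a"
    if "x \<in> kern ?V T" "i \<in> ?V" for x i
  proof -
    have "sum (?F x) K = x a + x m" using F_sum[of "\<lambda>_. 1" x] ker(1)[OF that(1)] const by simp
    then show ?thesis unfolding F_sum ker[OF that(1)] row'[OF that(2)] by (simp add: algebra_simps)
  qed
  have R: "mat_vec K ?R z i = ((\<Sum>j\<in>K. T i j * z j) + T i m * sum z K) + ((\<Sum>j\<in>K. T m j * z j) + T m m * sum z K)"
    if "i \<in> K" for z i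
  proof -
    have "mat_vec K ?R z i = (\<Sum>j\<in>K. (T i j + T i m + (T m j + T m m)) * z j)"
      using that by (simp add: mat_vec_restr) (auto simp: mat_vec_def shear_mat_def add.assoc intro!: sum.cong)
    then show ?thesis by (simp add: algebra_simps sum.distrib sum_distrib_left sum_distrib_right)
  qed
  have up_sum: "(\<Sum>j\<in>?I. c j * up z j) = (\<Sum>j\<in>K. c j * z j) + c m * sum z K" for c z
  proof -
    have "(\<Sum>j\<in>K. c j * up z j) = (\<Sum>j\<in>K. c j * z j)"
      using K(2) by (intro sum.cong) (auto simp: up_def)
    then show ?thesis using K by (simp add: up_def add.commute)
  qed
  show "bij_betw ?F (kern ?V T) (kern K ?R)"
  proof (rule bij_betw_byWitness[where f' = ?G])
    show "\<forall>x\<in>kern ?V T. ?G (?F x) = x"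
    proof (intro ballI ext)
      fix x i assume x: "x \<in> kern ?V T"
      have "t (?F x) = x a" unfolding t_def up_sum using F_row[OF x] by simp
      moreover have "sum (?F x) K = x a + x m" using F_sum[of "\<lambda>_. 1" x] ker(1)[OF x] const by simp
      moreover have "x i = 0" if "i \<notin> ?V" using x that by (auto simp: kern_def vec_on_def)
      ultimately show "?G (?F x) i = x i"
        using K ne by (auto simp: up_def add.assoc add.commute add.left_commute)
    qed
    show "\<forall>y\<in>kern K ?R. ?F (?G y) = y"
    proof (intro ballI ext)
      fix y i assume y: "y \<in> kern K ?R"
      then have "y a = 0" "i \<notin> K \<Longrightarrow> y i = 0" using K by (auto simp: kern_def vec_on_def)
      then show "?F (?G y) i = y i" using K ne by (auto simp: up_def add.assoc)
    qed
    show "?F ` kern ?V T \<subseteq> kern K ?R"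
    proof (rule image_subsetI)
      fix x assume x: "x \<in> kern ?V T"
      have "mat_vec K ?R (?F x) i = 0" for i
      proof (cases "i \<in> K")
        case True
        then show ?thesis unfolding R[OF True] using F_row[OF x, of i] F_row[OF x, of m] by simp
      qed (simp add: mat_vec_restr)
      then show "?F x \<in> kern K ?R" by (simp add: kern_def vec_on_def)
    qed
    show "?G ` kern K ?R \<subseteq> kern ?V T"
    proof (rule image_subsetI)
      fix z assume z: "z \<in> kern K ?R"
      then have up_a: "up z a = 0" using K ne by (auto simp: kern_def vec_on_def up_def)
      have onV: "mat_vec ?V T (?G z) i = (\<Sum>j\<in>?I. T i j * up z j) + t z" if i: "i \<in> ?V" for i
      proof -
        have "mat_vec ?V T (?G z) i = (\<Sum>j\<in>?V. T i j * up z j) + (\<Sum>j\<in>?V. T i j) * t z"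
          unfolding mat_vec_def by (simp only: sum_distrib_right sum.distrib[symmetric])
            (intro sum.cong refl, simp add: algebra_simps)
        then show ?thesis unfolding row[OF i] using K up_a by simp
      qed
      have onI: "mat_vec ?V T (?G z) i = 0" if i: "i \<in> ?I" for i
      proof (cases "i = m")
        case True
        have "mat_vec ?V T (?G z) m = t z + t z" using onV[of m] unfolding t_def[symmetric] by blast
        then show ?thesis unfolding True by (simp only: bit_add_self)
      next
        case False
        with i have "i \<in> K" by simp
        have "(\<Sum>j\<in>?I. T i j * up z j) + t z = mat_vec K ?R z i"
          unfolding t_def up_sum R[OF \<open>i \<in> K\<close>] ..
        also have "\<dots> = 0" using z by (simp add: kern_def)
        finally show ?thesis using onV[of i] i by simp
      qed
      have "sum (?G z) ?V = sum (up z) ?I + (up z a + t z + (t z + (\<Sum>j\<in>K. t z)))"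
        using K by (simp add: sum.distrib algebra_simps)
      also have "\<dots> = 0" unfolding const up_a using up_sum[of "\<lambda>_. 1" z] by simp
      finally have "(\<Sum>i\<in>?V. mat_vec ?V T (?G z) i) = 0" by (simp only: colsum)
      moreover have "(\<Sum>i\<in>?I. mat_vec ?V T (?G z) i) = 0" by (intro sum.neutral ballI onI)
      ultimately have "mat_vec ?V T (?G z) a = 0"
        using K(1) by (simp only: sum.insert[OF _ K(3)] add_0_right finite.insertI)
      then have "mat_vec ?V T (?G z) i = 0" for i
        using onI out by (cases "i \<in> ?V") auto
      then show "?G z \<in> kern ?V T" by (auto simp: kern_def vec_on_def)
    qed
  qed
qed

section \<open>Even and odd partitions as linear systems\<close>

definition adj :: "'a set set \<Rightarrow> 'a \<Rightarrow> 'a \<Rightarrow> bit" where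
  "adj E u v = of_bool ({u, v} \<in> E)"

definition pairs :: "'a set \<Rightarrow> 'a set set" where
  "pairs V = {e. e \<subseteq> V \<and> card e = 2}"

definition lap :: "'a set \<Rightarrow> 'a set set \<Rightarrow> 'a \<Rightarrow> 'a \<Rightarrow> bit" where
  "lap V E = restr V (\<lambda>u v. adj E u v + of_bool (u = v) * sum (adj E u) V)"

definition supp :: "('a \<Rightarrow> bit) \<Rightarrow> 'a set" where
  "supp x = {v. x v = 1}"

definition all_parity :: "bit \<Rightarrow> 'a graph \<Rightarrow> bool" where
  "all_parity t G \<longleftrightarrow> (\<forall>v\<in>verts G. of_nat (degree G v) = t)"

lemma all_degrees_parity: "all_degrees_even = all_parity 0" "all_degrees_odd = all_parity 1"
  by (auto simp: fun_eq_iff all_degrees_even_def all_degrees_odd_def all_parity_def of_nat_bit)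

lemma verts_induced_subgraph: "verts (induced_subgraph G A) = A"
  by (simp add: verts_def induced_subgraph_def)

lemma adj_commute: "adj E u v = adj E v u"
  by (simp add: adj_def insert_commute)

lemma adj_self: "E \<subseteq> pairs V \<Longrightarrow> adj E v v = 0"
  by (auto simp: adj_def pairs_def)

lemma lap_symm_on: "lap V E \<in> symm_on V"
  unfolding lap_def by (rule restr_in_symm_on) (auto simp: adj_commute)

lemma degree_bit:
  assumes "finite V" "E \<subseteq> pairs V" "A \<subseteq> V" "v \<in> A"
  shows "of_nat (degree (induced_subgraph (V, E) A) v) = (\<Sum>u\<in>A. adj E v u)"
proof -
  have "{e \<in> E. e \<subseteq> A \<and> v \<in> e} = (\<lambda>u. {v, u}) ` {u \<in> A. {v, u} \<in> E}"
  proof (intro equalityI subsetI)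
    fix e assume e: "e \<in> {e \<in> E. e \<subseteq> A \<and> v \<in> e}"
    with assms(2) have "card e = 2" by (auto simp: pairs_def)
    with e obtain u where "e = {v, u}" by (auto simp: card_2_iff)
    with e show "e \<in> (\<lambda>u. {v, u}) ` {u \<in> A. {v, u} \<in> E}" by auto
  qed (use assms in auto)
  moreover have "inj_on (\<lambda>u. {v, u}) {u \<in> A. {v, u} \<in> E}"
    by (auto simp: inj_on_def doubleton_eq_iff)
  ultimately have "degree (induced_subgraph (V, E) A) v = card {u \<in> A. {v, u} \<in> E}"
    by (simp add: degree_def induced_subgraph_def edges_def card_image conj_assoc)
  also have "(of_nat \<dots> :: bit) = (\<Sum>u\<in>A. adj E v u)"
    using finite_subset[OF assms(3,1)] by (simp add: adj_def of_bool_def sum.If_cases Int_def)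
  finally show ?thesis .
qed

lemma mat_vec_lap:
  assumes "finite V" "v \<in> V"
  shows "mat_vec V (lap V E) x v = (\<Sum>u\<in>V. adj E v u * x u) + sum (adj E v) V * x v"
proof -
  have "mat_vec V (lap V E) x v = (\<Sum>u\<in>V. adj E v u * x u + (if u = v then sum (adj E v) V * x v else 0))"
    unfolding mat_vec_def using assms(2)
    by (intro sum.cong refl) (auto simp: lap_def restr_def distrib_right)
  then show ?thesis using assms by (simp add: sum.distrib)
qed

lemma lap_diag: "E \<subseteq> pairs V \<Longrightarrow> v \<in> V \<Longrightarrow> lap V E v v = sum (adj E v) V"
  by (simp add: lap_def restr_def adj_self)

lemma lap_row_sum:
  assumes "finite V" "v \<in> V"
  shows "(\<Sum>u\<in>V. lap V E v u) = 0"
  using mat_vec_lap[OF assms, of E "\<lambda>_. 1"] by (simp add: mat_vec_def)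

text \<open>The two parts are told apart by \<open>1 + x u + x v\<close>, which is 1 iff \<open>u\<close> and \<open>v\<close> lie in the
  same part, so the parity of the degree of \<open>v\<close> inside its part is affine in \<open>x\<close>.\<close>

lemma partition_parity_iff:
  assumes V: "finite V" and E: "E \<subseteq> pairs V" and x: "x \<in> vec_on V"
  shows "all_parity s (induced_subgraph (V, E) (supp x)) \<and>
      all_parity t (induced_subgraph (V, E) (V - supp x)) \<longleftrightarrow>
    (\<forall>v\<in>V. mat_vec V (lap V E) x v + lap V E v v = (if x v = 1 then s else t))"
proof -
  have sub: "supp x \<subseteq> V" using x by (auto simp: supp_def vec_on_def)
  have deg: "of_nat (degree (induced_subgraph (V, E) A) v) = mat_vec V (lap V E) x v + lap V E v v"
    if A: "A = (if x v = 1 then supp x else V - supp x)" and v: "v \<in> V" for A v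
  proof -
    have "A \<subseteq> V" "v \<in> A" using A v sub by (auto simp: supp_def)
    then have "of_nat (degree (induced_subgraph (V, E) A) v) = (\<Sum>u\<in>A. adj E v u)"
      by (rule degree_bit[OF V E])
    also have "\<dots> = (\<Sum>u\<in>V. if u \<in> A then adj E v u else 0)"
      using \<open>A \<subseteq> V\<close> V by (simp add: sum.If_cases Int_absorb1)
    also have "\<dots> = (\<Sum>u\<in>V. adj E v u * x u + (adj E v u * x v + adj E v u))"
    proof (intro sum.cong refl)
      fix u assume "u \<in> V"
      then show "(if u \<in> A then adj E v u else 0) = adj E v u * x u + (adj E v u * x v + adj E v u)"
        unfolding A by (cases "x u"; cases "x v") (auto simp: supp_def)
    qed
    also have "\<dots> = mat_vec V (lap V E) x v + lap V E v v"
      unfolding mat_vec_lap[OF V v] lap_diag[OF E v] by (simp only: sum.distrib sum_distrib_right add.assoc)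
    finally show ?thesis .
  qed
  have deg1: "of_nat (degree (induced_subgraph (V, E) (supp x)) v) = mat_vec V (lap V E) x v + lap V E v v"
    if "v \<in> supp x" for v
  proof (rule deg)
    from that have "x v = 1" by (simp add: supp_def)
    then show "supp x = (if x v = 1 then supp x else V - supp x)" by simp
  qed (use sub that in blast)
  have deg0: "of_nat (degree (induced_subgraph (V, E) (V - supp x)) v) = mat_vec V (lap V E) x v + lap V E v v"
    if "v \<in> V - supp x" for v
  proof (rule deg)
    from that have "x v \<noteq> 1" by (simp add: supp_def)
    then show "V - supp x = (if x v = 1 then supp x else V - supp x)" by simp
  qed (use that in blast)
  have "(\<forall>v\<in>V. mat_vec V (lap V E) x v + lap V E v v = (if x v = 1 then s else t)) \<longleftrightarrow>
      (\<forall>v\<in>supp x. mat_vec V (lap V E) x v + lap V E v v = s) \<and>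
      (\<forall>v\<in>V - supp x. mat_vec V (lap V E) x v + lap V E v v = t)"
  proof -
    have "x v = 1 \<longleftrightarrow> v \<in> supp x" for v by (simp add: supp_def)
    then show ?thesis using sub by (auto dest: subsetD)
  qed
  then show ?thesis
    by (simp only: all_parity_def verts_induced_subgraph deg0 deg1 cong: ball_cong)
qed

lemma supp_inj: "supp x = supp y \<Longrightarrow> x = y"
proof
  fix v assume "supp x = supp y"
  then have "x v = 1 \<longleftrightarrow> y v = 1" by (auto simp: supp_def)
  then show "x v = y v" by (cases "x v"; cases "y v") auto
qed

lemma supp_of_bool: "supp (\<lambda>v. of_bool (v \<in> A)) = A"
  by (auto simp: supp_def)

lemma of_bool_vec_on: "(\<lambda>v. of_bool (v \<in> A)) \<in> vec_on I \<longleftrightarrow> A \<subseteq> I"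
  by (auto simp: vec_on_def)

lemma supp_subset: "x \<in> vec_on I \<Longrightarrow> supp x \<subseteq> I"
  by (auto simp: vec_on_def supp_def)

text \<open>An unordered partition is represented by its part avoiding \<open>a\<close>.\<close>

lemma card_bipartitions_same:
  assumes "a \<notin> I"
  shows "card (bipartitions P P (insert a I, E)) =
    card {x \<in> vec_on I. P (induced_subgraph (insert a I, E) (supp x)) \<and>
      P (induced_subgraph (insert a I, E) (insert a I - supp x))}" (is "card ?B = card ?X")
proof -
  let ?V = "insert a I"
  have "bij_betw (\<lambda>x. {supp x, ?V - supp x}) ?X ?B"
    unfolding bij_betw_def
  proof (intro conjI inj_onI equalityI subsetI)
    fix x y assume xy: "x \<in> ?X" "y \<in> ?X" and eq: "{supp x, ?V - supp x} = {supp y, ?V - supp y}"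
    have "supp x \<subseteq> I" "supp y \<subseteq> I" using xy by (simp_all add: supp_subset)
    then have "a \<notin> supp x" "a \<notin> supp y" using assms by auto
    then have "supp x \<noteq> ?V - supp y" by blast
    moreover from eq have "supp x = supp y \<or> supp x = ?V - supp y" by (simp only: doubleton_eq_iff) blast
    ultimately have "supp x = supp y" by simp
    then show "x = y" by (rule supp_inj)
  next
    fix p assume "p \<in> (\<lambda>x. {supp x, ?V - supp x}) ` ?X"
    then obtain x where x: "x \<in> ?X" "p = {supp x, ?V - supp x}" by blast
    then have "supp x \<subseteq> ?V" using supp_subset[of x I] by auto
    with x show "p \<in> ?B" unfolding bipartitions_def by (auto simp: verts_def)
  next
    fix p assume "p \<in> ?B"
    then obtain A B where AB: "p = {A, B}" "A \<union> B = ?V" "A \<inter> B = {}"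
        "P (induced_subgraph (?V, E) A)" "P (induced_subgraph (?V, E) B)"
      unfolding bipartitions_def by (auto simp: verts_def)
    have "\<exists>C. C \<subseteq> I \<and> p = {C, ?V - C} \<and> P (induced_subgraph (?V, E) C) \<and> P (induced_subgraph (?V, E) (?V - C))"
    proof (cases "a \<in> A")
      case True
      then have "B \<subseteq> I" "A = ?V - B" using AB(2,3) by auto
      with AB show ?thesis by (intro exI[of _ B]) auto
    next
      case False
      then have "A \<subseteq> I" "B = ?V - A" using AB(2,3) by auto
      with AB show ?thesis by (intro exI[of _ A]) auto
    qed
    then obtain C where C: "C \<subseteq> I" "p = {C, ?V - C}" "P (induced_subgraph (?V, E) C)"
      "P (induced_subgraph (?V, E) (?V - C))" by blast
    let ?x = "\<lambda>v. of_bool (v \<in> C) :: bit"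
    have "?x \<in> ?X" using C by (simp add: supp_of_bool of_bool_vec_on)
    moreover have "p = {supp ?x, ?V - supp ?x}" using C by (simp add: supp_of_bool)
    ultimately show "p \<in> (\<lambda>x. {supp x, ?V - supp x}) ` ?X" by blast
  qed
  then show ?thesis by (rule bij_betw_same_card[symmetric])
qed

text \<open>The parities label the parts, so x can mark the even one and no vertex has to be fixed.
  Two different x could give one partition only if both parts had all degrees even and odd at once,
  hence were empty, which \<open>V \<noteq> {}\<close> excludes.\<close>

lemma card_bipartitions_even_odd:
  assumes "V \<noteq> {}"
  shows "card (bipartitions (all_parity 0) (all_parity 1) (V, E)) =
    card {x \<in> vec_on V. all_parity 0 (induced_subgraph (V, E) (supp x)) \<and>
      all_parity 1 (induced_subgraph (V, E) (V - supp x))}" (is "card ?B = card ?X")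
proof -
  have empty: "A = {}" if "all_parity 0 (induced_subgraph (V, E) A)" "all_parity 1 (induced_subgraph (V, E) A)" for A
    using that by (auto simp: all_parity_def verts_def induced_subgraph_def)
  have "bij_betw (\<lambda>x. {supp x, V - supp x}) ?X ?B"
    unfolding bij_betw_def
  proof (intro conjI inj_onI equalityI subsetI)
    fix x y assume x: "x \<in> ?X" and y: "y \<in> ?X" and eq: "{supp x, V - supp x} = {supp y, V - supp y}"
    have "supp x = supp y"
    proof (rule ccontr)
      assume "supp x \<noteq> supp y"
      moreover from eq have "supp x = supp y \<and> V - supp x = V - supp y \<or> supp x = V - supp y \<and> V - supp x = supp y"
        by (simp only: doubleton_eq_iff)
      ultimately have eqs: "supp x = V - supp y" "supp y = V - supp x" by blast+
      have "all_parity 1 (induced_subgraph (V, E) (supp x))" using y unfolding eqs(1) by blast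
      moreover have "all_parity 0 (induced_subgraph (V, E) (supp x))" using x by blast
      ultimately have x0: "supp x = {}" by (intro empty)
      have "all_parity 1 (induced_subgraph (V, E) (supp y))" using x unfolding eqs(2) by blast
      moreover have "all_parity 0 (induced_subgraph (V, E) (supp y))" using y by blast
      ultimately have "supp y = {}" by (intro empty)
      with eqs(1) x0 assms show False by blast
    qed
    then show "x = y" by (rule supp_inj)
  next
    fix p assume "p \<in> (\<lambda>x. {supp x, V - supp x}) ` ?X"
    then obtain x where x: "x \<in> ?X" "p = {supp x, V - supp x}" by blast
    then have "supp x \<subseteq> V" using supp_subset[of x V] by auto
    with x show "p \<in> ?B" unfolding bipartitions_def by (auto simp: verts_def)
  next
    fix p assume "p \<in> ?B"
    then obtain A B where AB: "p = {A, B}" "A \<union> B = V" "A \<inter> B = {}"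
        "all_parity 0 (induced_subgraph (V, E) A)" "all_parity 1 (induced_subgraph (V, E) B)"
      unfolding bipartitions_def by (auto simp: verts_def)
    then have "A \<subseteq> V" "B = V - A" by auto
    let ?x = "\<lambda>v. of_bool (v \<in> A) :: bit"
    have "?x \<in> ?X" using AB \<open>A \<subseteq> V\<close> \<open>B = V - A\<close> by (simp add: supp_of_bool of_bool_vec_on)
    moreover have "p = {supp ?x, V - supp ?x}" using AB \<open>B = V - A\<close> by (simp add: supp_of_bool)
    ultimately show "p \<in> (\<lambda>x. {supp x, V - supp x}) ` ?X" by blast
  qed
  then show ?thesis by (rule bij_betw_same_card[symmetric])
qed

text \<open>The equation at \<open>a\<close> is the sum of the others.\<close>

lemma reduced_system_iff:
  assumes I: "finite I" "a \<notin> I" and E: "E \<subseteq> pairs (insert a I)" and t: "t = 0 \<or> odd (card I)"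
    and x: "x \<in> vec_on I"
  defines "L \<equiv> lap (insert a I) E"
  shows "(\<forall>v\<in>insert a I. mat_vec (insert a I) L x v + L v v = t) \<longleftrightarrow>
    mat_vec I (restr I L) x = (\<lambda>v. restr I L v v + (if v \<in> I then t else 0))"
proof -
  let ?V = "insert a I"
  have V: "finite ?V" using I by simp
  \<comment> \<open>The residuals h sum to 0 over all vertices: the Laplacian has zero column sums,
    its diagonal sums to 0 by the handshake lemma, and t contributes 0 because t = 0 or the number
    of vertices is even.\<close>
  define h where "h v = mat_vec ?V L x v + L v v + t" for v
  have "x a = 0" using x I(2) by (simp add: vec_on_def)
  then have mv: "mat_vec ?V L x v = mat_vec I L x v" for v
    using I by (simp add: mat_vec_def)
  have s1: "(\<Sum>v\<in>?V. mat_vec ?V L x v) = 0"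
    unfolding L_def sum_mat_vec[OF lap_symm_on] using lap_row_sum[OF V] by (intro sum.neutral) auto
  have s2: "(\<Sum>v\<in>?V. L v v) = 0"
  proof -
    have "(\<Sum>v\<in>?V. L v v) = (\<Sum>v\<in>?V. \<Sum>u\<in>?V. adj E v u)"
      unfolding L_def by (intro sum.cong refl lap_diag[OF E])
    also have "\<dots> = (\<Sum>v\<in>?V. adj E v v)" by (rule sum_symmetric_bit[OF V adj_commute])
    also have "\<dots> = 0" using adj_self[OF E] by (intro sum.neutral) auto
    finally show ?thesis .
  qed
  have s3: "(\<Sum>v\<in>?V. t) = 0"
  proof -
    have "(\<Sum>v\<in>?V. t) = of_nat (card ?V) * t" by (rule sum_constant)
    then show ?thesis using t I by (auto simp: of_nat_bit simp del: of_nat_Suc)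
  qed
  have "(\<Sum>v\<in>?V. h v) = 0" unfolding h_def sum.distrib s1 s2 s3 by simp
  then have "h a + (\<Sum>v\<in>I. h v) = 0" using I by simp
  then have "(\<forall>v\<in>I. h v = 0) \<Longrightarrow> h a = 0" by simp
  then have "(\<forall>v\<in>?V. h v = 0) \<longleftrightarrow> (\<forall>v\<in>I. h v = 0)" by blast
  moreover have "mat_vec ?V L x v + L v v = t \<longleftrightarrow> h v = 0" for v
    by (simp add: h_def bit_add_eq_0_iff)
  moreover have "h v = 0 \<longleftrightarrow> mat_vec I L x v = L v v + t" for v
    unfolding h_def mv add.assoc bit_add_eq_0_iff ..
  ultimately have "(\<forall>v\<in>?V. mat_vec ?V L x v + L v v = t) \<longleftrightarrow> (\<forall>v\<in>I. mat_vec I L x v = L v v + t)"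
    by (simp only:)
  also have "\<dots> \<longleftrightarrow> (\<forall>v. mat_vec I (restr I L) x v = restr I L v v + (if v \<in> I then t else 0))"
  proof -
    have "mat_vec I (restr I L) x v = restr I L v v + (if v \<in> I then t else 0) \<longleftrightarrow>
        (v \<in> I \<longrightarrow> mat_vec I L x v = L v v + t)" for v
      unfolding mat_vec_restr by (simp add: restr_def)
    then show ?thesis by (simp only: Ball_def)
  qed
  finally show ?thesis by (simp only: fun_eq_iff)
qed

text \<open>The right-hand side of the system is the diagonal plus the constant t on
  \<open>I\<close>. By \<open>diag_in_range\<close> the diagonal is orthogonal to the kernel, so t
  times the sum of w alone decides solvability.\<close>

lemma card_same_parity:
  assumes I: "finite I" "a \<notin> I" and E: "E \<subseteq> pairs (insert a I)" and t: "t = 0 \<or> odd (card I)"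
  defines "R \<equiv> restr I (lap (insert a I) E)"
  shows "card (bipartitions (all_parity t) (all_parity t) (insert a I, E)) =
    (if t = 0 \<or> (\<forall>w\<in>kern I R. sum w I = 0) then card (kern I R) else 0)"
proof -
  let ?V = "insert a I" and ?y = "\<lambda>v. R v v + (if v \<in> I then t else 0)"
  have R: "R \<in> symm_on I"
    unfolding R_def by (intro restr_in_symm_on symm_on_commute[OF lap_symm_on])
  have parity: "all_parity t (induced_subgraph (?V, E) (supp x)) \<and>
      all_parity t (induced_subgraph (?V, E) (?V - supp x)) \<longleftrightarrow>
      (\<forall>v\<in>?V. mat_vec ?V (lap ?V E) x v + lap ?V E v v = t)" if "x \<in> vec_on I" for x
  proof -
    have "x \<in> vec_on ?V" using that by (simp add: vec_on_def)
    from partition_parity_iff[OF _ E this, of t t] I(1) show ?thesis by (simp only: finite_insert if_cancel)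
  qed
  have "card (bipartitions (all_parity t) (all_parity t) (?V, E)) =
      card {x \<in> vec_on I. \<forall>v\<in>?V. mat_vec ?V (lap ?V E) x v + lap ?V E v v = t}"
    unfolding card_bipartitions_same[OF I(2)]
    by (intro arg_cong[where f = card] Collect_cong conj_cong refl parity)
  also have "\<dots> = card {x \<in> vec_on I. mat_vec I R x = ?y}"
    using reduced_system_iff[OF I E t] unfolding R_def
    by (intro arg_cong[where f = card] Collect_cong conj_cong refl) blast
  also have "\<dots> = (if \<forall>w\<in>kern I R. dot I ?y w = 0 then card (kern I R) else 0)"
  proof (rule card_solutions[OF I(1) R])
    show "?y \<in> vec_on I" using symm_on_outside[OF R] by (auto simp: vec_on_def)
  qed
  also have "(\<forall>w\<in>kern I R. dot I ?y w = 0) \<longleftrightarrow> t = 0 \<or> (\<forall>w\<in>kern I R. sum w I = 0)"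
  proof -
    have "dot I ?y w = t * sum w I" if "w \<in> kern I R" for w
    proof -
      have "dot I (\<lambda>v. R v v) w = 0"
        using diag_in_range[OF I(1) R] that unfolding range_eq_annihilator[OF I(1) R] by blast
      moreover have "dot I (\<lambda>v. if v \<in> I then t else 0) w = t * sum w I"
        by (simp add: dot_def sum_distrib_left)
      ultimately show ?thesis by (simp add: dot_add_left)
    qed
    then show ?thesis by auto
  qed
  finally show ?thesis .
qed

text \<open>The required parity, 0 on the part marked by x and 1 elsewhere, equals
  \<open>x v + 1\<close>. Moving \<open>x v\<close> to the left replaces L by L + 1, and the
  remaining 1 is what the diagonal gains, so the system is again T x = diag T and always
  solvable.\<close>

lemma card_even_odd:
  assumes V: "finite V" "V \<noteq> {}" and E: "E \<subseteq> pairs V"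
  shows "card (bipartitions (all_parity 0) (all_parity 1) (V, E)) =
    card (kern V (\<lambda>u v. lap V E u v + restr V (\<lambda>u v. of_bool (u = v)) u v))" (is "_ = card (kern V ?T)")
proof -
  let ?L = "lap V E" and ?D = "restr V (\<lambda>u v. of_bool (u = v) :: bit)"
  have D: "?D \<in> symm_on V" by (rule restr_in_symm_on) auto
  have T: "?T \<in> symm_on V" using lap_symm_on[of V E] D by (auto simp: symm_on_def)
  have mv: "mat_vec V ?T x v = mat_vec V ?L x v + x v" if "v \<in> V" for x v
  proof -
    have "mat_vec V ?T x v = mat_vec V ?L x v + (\<Sum>u\<in>V. if u = v then x v else 0)"
      unfolding mat_vec_def sum.distrib[symmetric] using that
      by (intro sum.cong refl) (auto simp: restr_def distrib_right)
    then show ?thesis using that V by simp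
  qed
  have "card (bipartitions (all_parity 0) (all_parity 1) (V, E)) =
      card {x \<in> vec_on V. \<forall>v\<in>V. mat_vec V ?L x v + ?L v v = (if x v = 1 then 0 else 1)}"
    unfolding card_bipartitions_even_odd[OF V(2)]
    by (intro arg_cong[where f = card] Collect_cong conj_cong refl partition_parity_iff[OF V(1) E])
  also have "\<dots> = card {x \<in> vec_on V. mat_vec V ?T x = (\<lambda>v. ?T v v)}"
  proof (intro arg_cong[where f = card] Collect_cong conj_cong refl)
    fix x assume "x \<in> vec_on V"
    have "mat_vec V ?L x v + ?L v v = (if x v = 1 then 0 else 1) \<longleftrightarrow> mat_vec V ?T x v = ?T v v"
      if "v \<in> V" for v
      unfolding mv[OF that] using that
      by (cases "x v"; cases "mat_vec V ?L x v"; cases "?L v v") (auto simp: restr_def)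
    moreover have "mat_vec V ?T x v = ?T v v" if "v \<notin> V" for v
      using symm_on_outside[OF T] that by (simp add: mat_vec_def)
    ultimately show "(\<forall>v\<in>V. mat_vec V ?L x v + ?L v v = (if x v = 1 then 0 else 1)) \<longleftrightarrow>
        mat_vec V ?T x = (\<lambda>v. ?T v v)"
      unfolding fun_eq_iff by blast
  qed
  also have "\<dots> = card (kern V ?T)"
  proof -
    from diag_in_range[OF V(1) T] obtain x0 where "x0 \<in> vec_on V" "(\<lambda>v. ?T v v) = mat_vec V ?T x0" by auto
    then show ?thesis using card_fibre[OF V(1), of x0 ?T] by (simp only:)
  qed
  finally show ?thesis .
qed

section \<open>Random graphs\<close>

lemma pairs_eq_potential_edges: "potential_edges n = pairs {1..n}"
  by (simp add: potential_edges_def pairs_def)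

lemma finite_pairs: "finite V \<Longrightarrow> finite (pairs V)"
  by (rule finite_subset[of _ "Pow V"]) (auto simp: pairs_def)

lemma binomial_random_graph_half:
  "binomial_random_graph n (1 / 2) = map_pmf (Pair {1..n}) (pmf_of_set (Pow (pairs {1..n})))"
proof -
  let ?P = "pairs {1..n}"
  have fin: "finite ?P" by (rule finite_pairs) simp
  have "Pi_pmf ?P False (\<lambda>_. bernoulli_pmf (1 / 2)) = pmf_of_set (PiE_dflt ?P False (\<lambda>_. UNIV))"
    unfolding bernoulli_pmf_half_conv_pmf_of_set using fin by (intro Pi_pmf_of_set) auto
  moreover have "map_pmf (\<lambda>f. {e \<in> ?P. f e}) (pmf_of_set (PiE_dflt ?P False (\<lambda>_. UNIV))) = pmf_of_set (Pow ?P)"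
  proof (rule map_pmf_of_set_bij_betw)
    show "bij_betw (\<lambda>f. {e \<in> ?P. f e}) (PiE_dflt ?P False (\<lambda>_. UNIV)) (Pow ?P)"
      by (rule bij_betw_byWitness[where f' = "\<lambda>E e. e \<in> E"]) (auto simp: PiE_dflt_def fun_eq_iff)
    show "finite (PiE_dflt ?P False (\<lambda>_. UNIV :: bool set))" using fin by (intro finite_PiE_dflt) auto
    show "PiE_dflt ?P False (\<lambda>_. UNIV :: bool set) \<noteq> {}"
    proof -
      have "(\<lambda>_. False) \<in> PiE_dflt ?P False (\<lambda>_. UNIV)" by (simp add: PiE_dflt_def)
      then show ?thesis by blast
    qed
  qed
  moreover have "binomial_random_graph n (1 / 2) =
      map_pmf (Pair {1..n}) (map_pmf (\<lambda>f. {e \<in> ?P. f e}) (Pi_pmf ?P False (\<lambda>_. bernoulli_pmf (1 / 2))))"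
    unfolding binomial_random_graph_def pairs_eq_potential_edges by (simp add: pmf.map_comp o_def)
  ultimately show ?thesis by simp
qed

text \<open>Off-diagonal entries recover the edges inside \<open>I\<close>; the diagonal entry at u,
  a degree parity, then recovers the edge from u to \<open>a\<close>. So the map is injective, and
  both sets have the same cardinality, 2 to the number of vertex pairs.\<close>

lemma map_lap_pmf_of_set:
  assumes I: "finite I" "a \<notin> I"
  shows "map_pmf (\<lambda>E. restr I (lap (insert a I) E)) (pmf_of_set (Pow (pairs (insert a I)))) =
    pmf_of_set (symm_on I)"
proof (rule map_pmf_of_set_bij_betw)
  let ?V = "insert a I" and ?f = "\<lambda>E. restr I (lap (insert a I) E)"
  have V: "finite ?V" using I by simp
  have inj: "inj_on ?f (Pow (pairs ?V))"
  proof (rule inj_onI)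
    fix E E' assume E: "E \<in> Pow (pairs ?V)" and E': "E' \<in> Pow (pairs ?V)" and eq: "?f E = ?f E'"
    have lap: "lap ?V E u v = lap ?V E' u v" if "u \<in> I" "v \<in> I" for u v
      using fun_cong[OF fun_cong[OF eq, of u], of v] that by (simp add: restr_def)
    have self: "adj E u u = 0" "adj E' u u = 0" for u
      using adj_self[of E ?V u] adj_self[of E' ?V u] E E' by simp_all
    have II: "adj E u v = adj E' u v" if "u \<in> I" "v \<in> I" for u v
    proof (cases "u = v")
      case False
      with lap[OF that] that show ?thesis by (simp add: lap_def restr_def)
    qed (simp add: self)
    have Ia: "adj E u a = adj E' u a" if "u \<in> I" for u
    proof -
      have "sum (adj E u) ?V = sum (adj E' u) ?V"
        using lap[OF that that] lap_diag[of E ?V u] lap_diag[of E' ?V u] E E' that by simp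
      then have "adj E u a + sum (adj E u) I = adj E' u a + sum (adj E' u) I" using I by simp
      moreover have "sum (adj E u) I = sum (adj E' u) I" using II[OF that] by (intro sum.cong) auto
      ultimately show ?thesis by simp
    qed
    have all: "adj E u v = adj E' u v" if uv: "u \<in> ?V" "v \<in> ?V" for u v
    proof -
      consider "u \<in> I" "v \<in> I" | "u \<in> I" "v = a" | "u = a" "v \<in> I" | "u = a" "v = a"
        using uv by blast
      then show ?thesis
      proof cases
        case 1
        then show ?thesis by (rule II)
      next
        case 2
        then show ?thesis using Ia by blast
      next
        case 3
        then show ?thesis using Ia[of v] adj_commute[of E a v] adj_commute[of E' a v] by simp
      next
        case 4
        then show ?thesis by (simp only: self)
      qed
    qed
    have "e \<in> E \<longleftrightarrow> e \<in> E'" if "e \<in> pairs ?V" for e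
    proof -
      from that obtain u v where "e = {u, v}" by (auto simp: pairs_def card_2_iff)
      moreover from this that have "u \<in> ?V" "v \<in> ?V" by (simp_all add: pairs_def)
      ultimately show ?thesis using all[of u v] by (simp add: adj_def of_bool_def split: if_splits)
    qed
    then show "E = E'" using E E' by blast
  qed
  have "?f ` Pow (pairs ?V) = symm_on I"
  proof (rule card_subset_eq)
    show "finite (symm_on I)" using I(1) by simp
    show "?f ` Pow (pairs ?V) \<subseteq> symm_on I"
      using symm_on_commute[OF lap_symm_on] by (intro image_subsetI restr_in_symm_on)
    have "card (pairs ?V) = card ?V choose 2" unfolding pairs_def by (rule n_subsets[OF V])
    then show "card (?f ` Pow (pairs ?V)) = card (symm_on I)"
      using I by (simp add: card_image[OF inj] card_Pow finite_pairs card_symm_on)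
  qed
  with inj show "bij_betw ?f (Pow (pairs ?V)) (symm_on I)" by (simp add: bij_betw_def)
  show "finite (Pow (pairs ?V))" using finite_pairs[OF V] by simp
qed auto

lemma map_binomial_random_graph_half:
  assumes "{1..n} = insert a I" "finite I" "a \<notin> I"
    and "\<And>E. E \<subseteq> pairs (insert a I) \<Longrightarrow> f (insert a I, E) = g (restr I (lap (insert a I) E))"
  shows "map_pmf f (binomial_random_graph n (1 / 2)) = map_pmf g (pmf_of_set (symm_on I))"
proof -
  let ?P = "Pow (pairs (insert a I))"
  have fin: "finite ?P" using finite_pairs[of "insert a I"] assms(2) by simp
  have "map_pmf f (binomial_random_graph n (1 / 2)) = map_pmf (\<lambda>E. f (insert a I, E)) (pmf_of_set ?P)"
    unfolding binomial_random_graph_half assms(1) by (simp add: pmf.map_comp o_def)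
  also have "\<dots> = map_pmf (\<lambda>E. g (restr I (lap (insert a I) E))) (pmf_of_set ?P)"
  proof (rule map_pmf_cong[OF refl])
    have "set_pmf (pmf_of_set ?P) = ?P" using fin by (intro set_pmf_of_set) auto
    then show "f (insert a I, E) = g (restr I (lap (insert a I) E))" if "E \<in> set_pmf (pmf_of_set ?P)" for E
      using that assms(4) by simp
  qed
  also have "\<dots> = map_pmf g (map_pmf (\<lambda>E. restr I (lap (insert a I) E)) (pmf_of_set ?P))"
    by (simp add: pmf.map_comp o_def)
  finally show ?thesis unfolding map_lap_pmf_of_set[OF assms(2,3)] .
qed

section \<open>Exact laws of the three counts\<close>

lemma X20_law:
  assumes "n \<ge> 1"
  shows "map_pmf (\<lambda>G. real (X20 G)) (binomial_random_graph n (1 / 2)) = map_pmf real (kern_law {1..<n})"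
proof -
  have V: "{1..n} = insert n {1..<n}" using assms by auto
  have "map_pmf (\<lambda>G. real (X20 G)) (binomial_random_graph n (1 / 2)) =
      map_pmf (\<lambda>S. real (card (kern {1..<n} S))) (pmf_of_set (symm_on {1..<n}))"
    by (rule map_binomial_random_graph_half[OF V])
      (auto simp: X20_def all_degrees_parity card_same_parity)
  then show ?thesis by (simp add: kern_law_def pmf.map_comp o_def)
qed

text \<open>Deleting vertex \<open>2 * m\<close> leaves an odd number of indices, as
  \<open>card_same_parity\<close> requires for t = 1. The shear with pivot 1 keeps the uniform law
  and turns solvability into the vanishing bit at 1.\<close>

lemma X02_law:
  assumes "m \<ge> 1"
  shows "map_pmf (\<lambda>G. real (X02 G)) (binomial_random_graph (2 * m) (1 / 2)) =
    map_pmf (\<lambda>(w, v). if v then real w else 0) (kern_vanish_law 1 (insert 1 {2..<2 * m}))"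
proof -
  let ?K = "{2..<2 * m}"
  let ?I = "insert 1 ?K"
  let ?g = "\<lambda>S. if vanish_at 1 ?I S then real (card (kern ?I S)) else 0"
  have V: "{1..2 * m} = insert (2 * m) ?I" using assms by auto
  have K: "finite ?K" "1 \<notin> ?K" by auto
  have odd: "odd (card ?I)" using assms by simp
  have "map_pmf (\<lambda>G. real (X02 G)) (binomial_random_graph (2 * m) (1 / 2)) =
      map_pmf (\<lambda>S. ?g (shear_mat ?K 1 S)) (pmf_of_set (symm_on ?I))"
  proof (rule map_binomial_random_graph_half[OF V])
    fix E assume E: "E \<subseteq> pairs (insert (2 * m) ?I)"
    show "real (X02 (insert (2 * m) ?I, E)) = ?g (shear_mat ?K 1 (restr ?I (lap (insert (2 * m) ?I) E)))"
      unfolding kern_shear_mat[OF K] X02_def all_degrees_parity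
      by (subst card_same_parity[OF _ _ E]) (use odd assms in auto)
  qed (use assms in auto)
  also have "\<dots> = map_pmf ?g (map_pmf (shear_mat ?K 1) (pmf_of_set (symm_on ?I)))"
    by (simp only: pmf.map_comp o_def)
  also have "\<dots> = map_pmf ?g (pmf_of_set (symm_on ?I))"
    unfolding map_shear_mat_pmf_of_symm[OF K] ..
  also have "\<dots> = map_pmf (\<lambda>(w, v). if v then real w else 0) (kern_vanish_law 1 ?I)"
    by (simp add: kern_vanish_law_def pmf.map_comp o_def del: One_nat_def)
  finally show ?thesis .
qed

lemma lap_plus_identity:
  fixes E :: "'a set set"
  assumes I: "finite I" "a \<notin> I"
  defines "V \<equiv> insert a I"
  defines "T \<equiv> \<lambda>u v. lap V E u v + restr V (\<lambda>u v. of_bool (u = v)) u v"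
  shows "T \<in> symm_on V" "i \<in> V \<Longrightarrow> (\<Sum>j\<in>V. T i j) = 1"
proof -
  have "restr V (\<lambda>u v. of_bool (u = v)) \<in> symm_on V" by (rule restr_in_symm_on) auto
  then show "T \<in> symm_on V" unfolding T_def using lap_symm_on[of V E] by (simp add: symm_on_def)
  assume i: "i \<in> V"
  have V: "finite V" using I by (simp add: V_def)
  have "(\<Sum>j\<in>V. restr V (\<lambda>u v. of_bool (u = v) :: bit) i j) = (\<Sum>j\<in>V. if j = i then 1 else 0)"
    using i by (intro sum.cong refl) (auto simp: restr_def)
  then show "(\<Sum>j\<in>V. T i j) = 1"
    unfolding T_def sum.distrib lap_row_sum[OF V i] using i V by simp
qed

text \<open>The reduction yields the reduced Laplacian plus the fixed matrix \<open>?C\<close>,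
  identity plus all-ones, and such a translation keeps the uniform law.\<close>

lemma X11_law_odd:
  assumes "odd n"
  shows "map_pmf (\<lambda>G. real (X11 G)) (binomial_random_graph n (1 / 2)) = map_pmf real (kern_law {1..<n})"
proof -
  let ?I = "{1..<n}"
  let ?V = "insert n ?I"
  let ?C = "restr ?I (\<lambda>u v. of_bool (u = v) + 1)"
  have n: "n \<ge> 1" using assms by (cases n) auto
  then have V: "{1..n} = ?V" by auto
  have I: "finite ?I" "n \<notin> ?I" "even (card ?I)" using assms by auto
  have C: "?C \<in> symm_on ?I" by (rule restr_in_symm_on) auto
  have "map_pmf (\<lambda>G. real (X11 G)) (binomial_random_graph n (1 / 2)) =
      map_pmf (\<lambda>S. real (card (kern ?I (\<lambda>i j. S i j + ?C i j)))) (pmf_of_set (symm_on ?I))"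
  proof (rule map_binomial_random_graph_half[OF V I(1,2)])
    fix E assume E: "E \<subseteq> pairs ?V"
    let ?T = "\<lambda>u v. lap ?V E u v + restr ?V (\<lambda>u v. of_bool (u = v)) u v"
    have "X11 (?V, E) = card (kern ?V ?T)"
      unfolding X11_def all_degrees_parity by (rule card_even_odd[OF _ _ E]) auto
    also have "\<dots> = card (kern ?I (restr ?I (\<lambda>i j. ?T i j + 1)))"
      by (rule card_kern_row_sum_odd[OF I lap_plus_identity[OF I(1,2)]])
    also have "restr ?I (\<lambda>i j. ?T i j + 1) = (\<lambda>i j. restr ?I (lap ?V E) i j + ?C i j)"
      by (auto simp: fun_eq_iff restr_def add.assoc)
    finally show "real (X11 (?V, E)) = real (card (kern ?I (\<lambda>i j. restr ?I (lap ?V E) i j + ?C i j)))"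
      by simp
  qed
  also have "\<dots> = map_pmf (\<lambda>S. real (card (kern ?I S)))
      (map_pmf (\<lambda>S i j. S i j + ?C i j) (pmf_of_set (symm_on ?I)))"
    by (simp add: pmf.map_comp o_def)
  also have "\<dots> = map_pmf real (kern_law ?I)"
    unfolding map_add_pmf_of_symm[OF I(1) C] by (simp add: kern_law_def pmf.map_comp o_def)
  finally show ?thesis .
qed

text \<open>Passing to the quotient costs two indices, n and 1. Adding the identity, shearing and
  restricting to a principal submatrix each carry a uniform law to a uniform law.\<close>

lemma X11_law_even:
  assumes "even n" "n \<ge> 2"
  shows "map_pmf (\<lambda>G. real (X11 G)) (binomial_random_graph n (1 / 2)) = map_pmf real (kern_law {2..<n})"
proof -
  let ?K = "{2..<n}"
  let ?I = "insert 1 ?K"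
  let ?V = "insert n ?I"
  let ?C = "restr ?I (\<lambda>u v. of_bool (u = v))"
  have V: "{1..n} = ?V" using assms by auto
  have K: "finite ?K" "1 \<notin> ?K" "n \<notin> ?I" "even (card ?K)" using assms by auto
  have I: "finite ?I" by simp
  have C: "?C \<in> symm_on ?I" by (rule restr_in_symm_on) auto
  have "map_pmf (\<lambda>G. real (X11 G)) (binomial_random_graph n (1 / 2)) =
      map_pmf (\<lambda>S. real (card (kern ?K (restr ?K (shear_mat ?K 1 (\<lambda>i j. S i j + ?C i j))))))
        (pmf_of_set (symm_on ?I))"
  proof (rule map_binomial_random_graph_half[OF V I K(3)])
    fix E assume E: "E \<subseteq> pairs ?V"
    let ?T = "\<lambda>u v. lap ?V E u v + restr ?V (\<lambda>u v. of_bool (u = v)) u v"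
    have "X11 (?V, E) = card (kern ?V ?T)"
      unfolding X11_def all_degrees_parity by (rule card_even_odd[OF _ _ E]) auto
    also have "\<dots> = card (kern ?K (restr ?K (shear_mat ?K 1 ?T)))"
      by (rule card_kern_row_sum_even[OF K lap_plus_identity[OF I K(3)]])
    also have "restr ?K (shear_mat ?K 1 ?T) =
        restr ?K (shear_mat ?K 1 (\<lambda>i j. restr ?I (lap ?V E) i j + ?C i j))"
      by (auto simp: fun_eq_iff restr_def shear_mat_def)
    finally show "real (X11 (?V, E)) =
        real (card (kern ?K (restr ?K (shear_mat ?K 1 (\<lambda>i j. restr ?I (lap ?V E) i j + ?C i j)))))"
      by simp
  qed
  also have "\<dots> = map_pmf (\<lambda>S. real (card (kern ?K S))) (map_pmf (restr ?K) (map_pmf (shear_mat ?K 1)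
      (map_pmf (\<lambda>S i j. S i j + ?C i j) (pmf_of_set (symm_on ?I)))))"
    by (simp only: pmf.map_comp o_def)
  also have "\<dots> = map_pmf real (kern_law ?K)"
    unfolding map_add_pmf_of_symm[OF I C] map_shear_mat_pmf_of_symm[OF K(1,2)] map_restr_pmf_of_symm[OF K(1,2)]
    by (simp add: kern_law_def pmf.map_comp o_def)
  finally show ?thesis .
qed

lemma filterlim_at_top_mono_nat:
  fixes f :: "nat \<Rightarrow> nat"
  assumes "\<And>n. n \<le> f n + k"
  shows "filterlim f at_top sequentially"
  unfolding filterlim_at_top
proof
  fix Z show "eventually (\<lambda>n. Z \<le> f n) sequentially"
  proof (rule eventually_sequentiallyI[of "Z + k"])
    fix n assume "Z + k \<le> n"
    with assms[of n] show "Z \<le> f n" by linarith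
  qed
qed

lemma X20_weak_conv:
  "weak_conv_m (\<lambda>n. law (binomial_random_graph n (1 / 2)) (\<lambda>G. real (X20 G))) (law limit_X (\<lambda>x. x))"
  unfolding limit_X_def
proof (rule weak_conv_law)
  show "eventually (\<lambda>n. map_pmf (\<lambda>G. real (X20 G)) (binomial_random_graph n (1 / 2)) =
      map_pmf real (kern_law {1..<n})) sequentially"
    by (rule eventually_sequentiallyI[of 1]) (rule X20_law)
  show "(\<lambda>n. pmf (kern_law {1..<n}) x) \<longlonglongrightarrow> pmf (map_pmf (\<lambda>k. 2 ^ k) limit_corank) x"
    if "x \<in> set_pmf (map_pmf (\<lambda>k. 2 ^ k) limit_corank)" for x
    by (rule kern_law_LIMSEQ[OF _ _ that]) (auto intro!: filterlim_at_top_mono_nat[of _ 1])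
qed

text \<open>The index set has n - 1 or n - 2 elements according to parity; the limit needs only that
  this size tends to infinity, so both parities share it.\<close>

lemma X11_weak_conv:
  "weak_conv_m (\<lambda>n. law (binomial_random_graph n (1 / 2)) (\<lambda>G. real (X11 G))) (law limit_X (\<lambda>x. x))"
  unfolding limit_X_def
proof (rule weak_conv_law)
  let ?J = "\<lambda>n::nat. if odd n then {1..<n} else {2..<n}"
  show "eventually (\<lambda>n. map_pmf (\<lambda>G. real (X11 G)) (binomial_random_graph n (1 / 2)) =
      map_pmf real (kern_law (?J n))) sequentially"
    by (rule eventually_sequentiallyI[of 2]) (simp add: X11_law_odd X11_law_even)
  show "(\<lambda>n. pmf (kern_law (?J n)) x) \<longlonglongrightarrow> pmf (map_pmf (\<lambda>k. 2 ^ k) limit_corank) x"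
    if "x \<in> set_pmf (map_pmf (\<lambda>k. 2 ^ k) limit_corank)" for x
    by (rule kern_law_LIMSEQ[OF _ _ that]) (auto intro!: filterlim_at_top_mono_nat[of _ 2])
qed

lemma X02_weak_conv:
  "weak_conv_m (\<lambda>m. law (binomial_random_graph (2 * m) (1 / 2)) (\<lambda>G. real (X02 G))) (law limit_Z (\<lambda>x. x))"
  unfolding limit_Z_def
proof (rule weak_conv_law)
  show "eventually (\<lambda>m. map_pmf (\<lambda>G. real (X02 G)) (binomial_random_graph (2 * m) (1 / 2)) =
      map_pmf (\<lambda>(w, v). if v then real w else 0) (kern_vanish_law 1 (insert 1 {2..<2 * m}))) sequentially"
    by (rule eventually_sequentiallyI[of 1]) (rule X02_law)
  show "(\<lambda>m. pmf (kern_vanish_law 1 (insert 1 {2..<2 * m})) x) \<longlonglongrightarrow> pmf limit_joint x"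
    if "x \<in> set_pmf limit_joint" for x :: "nat \<times> bool"
    by (rule kern_vanish_law_LIMSEQ[OF _ _ _ that]) (auto intro!: filterlim_at_top_mono_nat[of _ 2])
qed

theorem theorem1p7:
  fixes c :: real
  assumes c_def: "c = (\<Prod>i. 1 - 1 / 2 ^ (2 * i + 1))"
  shows
    "convergent_prod (\<lambda>i::nat. 1 - 1 / 2 ^ (2 * i + 1) :: real) \<and>
     summable (\<lambda>j::nat. \<Prod>i=1..j. inverse (2 ^ i - 1 :: real)) \<and>
     c = inverse (\<Sum>j. \<Prod>i=1..j. inverse (2 ^ i - 1)) \<and>
     (\<exists>X :: real pmf.
        (\<forall>k::nat. pmf X (2 ^ k) = c * (\<Prod>i=1..k. inverse (2 ^ i - 1))) \<and>
        (\<forall>x. (\<nexists>k::nat. x = 2 ^ k) \<longrightarrow> pmf X x = 0) \<and>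
        weak_conv_m (\<lambda>n. law (binomial_random_graph n (1 / 2)) (\<lambda>G. real (X20 G)))
          (law X (\<lambda>x. x)) \<and>
        weak_conv_m (\<lambda>n. law (binomial_random_graph n (1 / 2)) (\<lambda>G. real (X11 G)))
          (law X (\<lambda>x. x))) \<and>
     (\<exists>Z :: real pmf.
        (\<forall>k::nat. pmf Z (2 ^ k) = c * inverse (2 ^ k) * (\<Prod>i=1..k. inverse (2 ^ i - 1))) \<and>
        pmf Z 0 = 1 / 3 \<and>
        (\<forall>x. x \<noteq> 0 \<and> (\<nexists>k::nat. x = 2 ^ k) \<longrightarrow> pmf Z x = 0) \<and>
        weak_conv_m (\<lambda>m. law (binomial_random_graph (2 * m) (1 / 2)) (\<lambda>G. real (X02 G)))
          (law Z (\<lambda>x. x)))"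
proof -
  have c: "c = limc" using c_def limc_eq by simp
  have "(\<lambda>i::nat. 1 - 1 / 2 ^ (2 * i + 1) :: real) = (\<lambda>i. 1 - 1 / 2 * (1 / 4) ^ i)"
    by (simp add: fun_eq_iff power_mult power_divide)
  then have 1: "convergent_prod (\<lambda>i::nat. 1 - 1 / 2 ^ (2 * i + 1) :: real)"
    using convergent_prod_geometric[of "1 / 2" "1 / 4"] by simp
  have 2: "summable wt" using summable_wt_power[of 1] by simp
  have "c * (\<Sum>j. wt j) = 1" using wt_series_1 c by (simp add: wt_series_def)
  then have 3: "c = inverse (\<Sum>j. wt j)" by (metis inverse_unique inverse_inverse_eq)
  have X: "pmf limit_X (2 ^ k) = c * wt k" for k by (simp add: pmf_limit_X c)
  have Z: "pmf limit_Z (2 ^ k) = c * inverse (2 ^ k) * wt k" for k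
    by (simp add: pmf_limit_Z c divide_inverse mult.commute mult.left_commute)
  show ?thesis
    unfolding wt_def[symmetric]
    using 1 2 3 X Z X20_weak_conv X11_weak_conv X02_weak_conv
      pmf_limit_X_outside pmf_limit_Z_outside pmf_limit_Z_0
    by blast
qed

end
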